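(* Let $\mathcal{S}$, $\mathbf{Y}$, $\mathbf{Z}$ be random vectors whose components are variables of a linear non-Gaussian acyclic causal model, and suppose they are related by $$\mathbf{Y} = A\,\mathcal{S} + \mathbf{E}_Y,\qquad \mathbf{Z} = B\,\mathcal{S} + \mathbf{E}_Z ,$$ where $A$, $B$ are constant matrices. Denote by $s$ the dimensionality of $\mathcal{S}$ and assume that $A$ has full column rank. If 1) $\dim(\mathbf{Y}) > s$, 2) $\mathbf{E}_Y$ is independent of $\mathcal{S}$, 3) $\mathbf{E}_Y$ is independent of $\mathbf{E}_Z$ (it is not assumed that $\mathbf{E}_Z$ is independent of $\mathcal{S}$), and 4) the cross-covariance matrix $\boldsymbol{\Sigma}_{\mathcal{S},\mathbf{Z}} = \mathbb{E}[\mathcal{S}\mathbf{Z}^\intercal]$ has rank $s$, then $(\mathbf{Z},\mathbf{Y})$ satisfies the GIN condition, i.e. $E_{\mathbf{Y}||\mathbf{Z}}=\omega^\intercal\mathbf{Y}$ is independent of $\mathbf{Z}$.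
   Context: Linear non-Gaussian acyclic causal model: a finite set of zero-mean random variables $\mathbf{V}=\{V_1,\dots,V_n\}$ (some of which may be latent) with a directed acyclic graph on $\mathbf V$ such that $V_i=\sum_{V_j\in \mathbf{Pa}(V_i)} b_{ij}V_j+\varepsilon_{V_i}$, where the noises $\varepsilon_{V_1},\dots,\varepsilon_{V_n}$ are mutually independent continuous random variables, each non-Gaussian with non-zero (finite) variance. GIN (Generalized Independent Noise) condition: for random vectors $\mathbf{Y},\mathbf{Z}$ of variables of such a model, the surrogate variable of $\mathbf{Y}$ relative to $\mathbf{Z}$ is $E_{\mathbf{Y}||\mathbf{Z}}:=\omega^\intercal\mathbf{Y}$, where $\omega$ satisfies $\omega^\intercal\mathbb{E}[\mathbf{Y}\mathbf{Z}^\intercal]=\mathbf 0$ and $\omega\neq\mathbf 0$. $(\mathbf{Z},\mathbf{Y})$ follows the GIN condition if and only if $E_{\mathbf{Y}||\mathbf{Z}}$ is independent of $\mathbf{Z}$; that is, at least one such $\omega$ exists, and $\omega^\intercal\mathbf{Y}$ is statistically independent of $\mathbf{Z}$ for every such $\omega$. *)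

theory Defs
  imports "HOL-Probability.Probability" "Jordan_Normal_Form.DL_Rank"
begin

unbundle no vec_syntax
unbundle no inner_syntax

text \<open>
  Random vectors take values in the type \<^typ>\<open>real vec\<close> of vectors of arbitrary dimension.
  \<open>vec_borel n\<close> is the Borel sigma-algebra of \<open>n\<close>-dimensional real space, transported
  to \<^term>\<open>carrier_vec n\<close>, i.e. the sigma-algebra generated by the \<open>n\<close> coordinate functions.
\<close>

definition vec_borel :: "nat \<Rightarrow> real vec measure" where
  "vec_borel n =
     vimage_algebra (carrier_vec n) (\<lambda>v. \<lambda>i\<in>{..<n}. v $ i) (Pi\<^sub>M {..<n} (\<lambda>_. borel))"

lemma measurable_vec_borel_iff:
  "U \<in> measurable M (vec_borel n) \<longleftrightarrow>
     U \<in> space M \<rightarrow> carrier_vec n \<and> (\<forall>i<n. (\<lambda>x. U x $ i) \<in> borel_measurable M)"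
proof
  assume U: "U \<in> measurable M (vec_borel n)"
  have c: "U \<in> space M \<rightarrow> carrier_vec n"
    using measurable_space[OF U] by (auto simp: vec_borel_def)
  have r: "(\<lambda>v. \<lambda>i\<in>{..<n}. v $ i) \<in> measurable (vec_borel n) (Pi\<^sub>M {..<n} (\<lambda>_. borel))"
    unfolding vec_borel_def by (rule measurable_vimage_algebra1) (auto simp: space_PiM)
  have "(\<lambda>x. U x $ i) \<in> borel_measurable M" if i: "i < n" for i
  proof -
    have "(\<lambda>x. (\<lambda>j\<in>{..<n}. U x $ j) i) \<in> borel_measurable M"
      using measurable_compose[OF measurable_compose[OF U r] measurable_component_singleton[of i]] i
      by simp
    then show ?thesis using i by simp
  qed
  with c show "U \<in> space M \<rightarrow> carrier_vec n \<and> (\<forall>i<n. (\<lambda>x. U x $ i) \<in> borel_measurable M)"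
    by blast
next
  assume *: "U \<in> space M \<rightarrow> carrier_vec n \<and> (\<forall>i<n. (\<lambda>x. U x $ i) \<in> borel_measurable M)"
  show "U \<in> measurable M (vec_borel n)"
    unfolding vec_borel_def
    by (rule measurable_vimage_algebra2) (use * in \<open>auto intro!: measurable_restrict\<close>)
qed

text \<open>
  \<^const>\<open>prob_space.indep_var\<close> forces both random variables to have the same value type; this
  is the same notion for two possibly different value types.
\<close>

definition indep_rv ::
    "'a measure \<Rightarrow> 'b measure \<Rightarrow> ('a \<Rightarrow> 'b) \<Rightarrow> 'c measure \<Rightarrow> ('a \<Rightarrow> 'c) \<Rightarrow> bool" where
  "indep_rv M N U N' W \<longleftrightarrow>
     U \<in> measurable M N \<and> W \<in> measurable M N' \<and>
     prob_space.indep_set M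
       (sigma_sets (space M) {U -` A \<inter> space M | A. A \<in> sets N})
       (sigma_sets (space M) {W -` A \<inter> space M | A. A \<in> sets N'})"

lemma (in prob_space) indep_rv_iff_indep_var:
  "indep_rv M N U N' W \<longleftrightarrow> indep_var N U N' W"
  unfolding indep_rv_def indep_var_eq by blast

text \<open>
  \<open>(j, i) \<in> G\<close> is the edge from \<open>j\<close> to \<open>i\<close>, so the parents of \<open>i\<close> are
  \<open>{j. (j, i) \<in> G}\<close>. Continuity of the noises is continuity of their distribution
  functions; having a density is a special case.
\<close>

locale lin_nongaussian_model = prob_space M
  for M :: "'a measure" +
  fixes V :: "'v set"
    and G :: "('v \<times> 'v) set"
    and b :: "'v \<Rightarrow> 'v \<Rightarrow> real"
    and X :: "'v \<Rightarrow> 'a \<Rightarrow> real"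
    and noise :: "'v \<Rightarrow> 'a \<Rightarrow> real"
  assumes finite_V: "finite V"
    and G_subset: "G \<subseteq> V \<times> V"
    and acyclic_G: "acyclic G"
    and structural: "\<And>i x. i \<in> V \<Longrightarrow> x \<in> space M \<Longrightarrow>
          X i x = (\<Sum>j\<in>{j. (j, i) \<in> G}. b i j * X j x) + noise i x"
    and zero_mean: "\<And>i. i \<in> V \<Longrightarrow> integrable M (X i) \<and> expectation (X i) = 0"
    and noise_indep: "indep_vars (\<lambda>_. borel) noise V"
    and noise_continuous: "\<And>i t. i \<in> V \<Longrightarrow> isCont (cdf (distr M borel (noise i))) t"
    and noise_non_gaussian: "\<And>i. i \<in> V \<Longrightarrow>
          \<not> (\<exists>\<mu> \<sigma>. \<sigma> > 0 \<and> distributed M lborel (noise i) (normal_density \<mu> \<sigma>))"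
    and noise_finite_variance: "\<And>i. i \<in> V \<Longrightarrow> integrable M (\<lambda>x. (noise i x)\<^sup>2)"
    and noise_nonzero_variance: "\<And>i. i \<in> V \<Longrightarrow> variance (noise i) \<noteq> 0"

definition vector_of_variables ::
    "'a measure \<Rightarrow> 'v set \<Rightarrow> ('v \<Rightarrow> 'a \<Rightarrow> real) \<Rightarrow> nat \<Rightarrow> ('a \<Rightarrow> real vec) \<Rightarrow> bool" where
  "vector_of_variables M V X n U \<longleftrightarrow>
     (\<forall>x\<in>space M. U x \<in> carrier_vec n) \<and>
     (\<forall>i<n. \<exists>v\<in>V. \<forall>x\<in>space M. U x $ i = X v x)"

definition cross_cov ::
    "'a measure \<Rightarrow> nat \<Rightarrow> ('a \<Rightarrow> real vec) \<Rightarrow> nat \<Rightarrow> ('a \<Rightarrow> real vec) \<Rightarrow> real mat" where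
  "cross_cov M m U n W = mat m n (\<lambda>(i, j). \<integral>x. U x $ i * W x $ j \<partial>M)"

text \<open>The last conjunct is \<open>\<omega>\<^sup>T E[Y Z\<^sup>T] = 0\<close>, read as an equation of row vectors.\<close>

definition surrogate_weight ::
    "'a measure \<Rightarrow> nat \<Rightarrow> ('a \<Rightarrow> real vec) \<Rightarrow> nat \<Rightarrow> ('a \<Rightarrow> real vec) \<Rightarrow> real vec \<Rightarrow> bool" where
  "surrogate_weight M q Z p Y \<omega> \<longleftrightarrow>
     \<omega> \<in> carrier_vec p \<and> \<omega> \<noteq> 0\<^sub>v p \<and>
     mat_of_row \<omega> * cross_cov M p Y q Z = 0\<^sub>m 1 q"

definition GIN ::
    "'a measure \<Rightarrow> nat \<Rightarrow> ('a \<Rightarrow> real vec) \<Rightarrow> nat \<Rightarrow> ('a \<Rightarrow> real vec) \<Rightarrow> bool" where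
  "GIN M q Z p Y \<longleftrightarrow>
     (\<exists>\<omega>. surrogate_weight M q Z p Y \<omega>) \<and>
     (\<forall>\<omega>. surrogate_weight M q Z p Y \<omega> \<longrightarrow>
        indep_rv M borel (\<lambda>x. \<omega> \<bullet> Y x) (vec_borel q) Z)"

end

theory Submission
  imports Defs "HOL-Complex_Analysis.Conformal_Mappings"
begin

unbundle no vec_syntax
unbundle no inner_syntax

text \<open>
  Since \<open>E[Y Z\<^sup>T] = A E[S Z\<^sup>T]\<close> and \<open>E[S Z\<^sup>T]\<close> has full row rank, a weight \<open>\<omega>\<close> annihilates \<open>E[Y Z\<^sup>T]\<close> iff
  \<open>\<omega>\<^sup>T A = 0\<close>, and then \<open>\<omega>\<^sup>T Y = \<omega>\<^sup>T EY\<close> is independent of each component of \<open>S\<close> and of \<open>EZ\<close>. Pairwise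
  independence does not by itself give independence of \<open>Z = B S + EZ\<close>. However, all these variables are
  linear combinations of the independent noises, and by the Darmois-Skitovich theorem two independent
  combinations have no non-Gaussian noise in common. So \<open>\<omega>\<^sup>T EY\<close> and \<open>Z\<close> involve disjoint sets of noises.

  Darmois-Skitovich: independence of the two forms is a functional equation for the logarithms of the
  characteristic functions, whose solutions are polynomials near \<open>0\<close>. If the modulus of the
  characteristic function of \<open>L = U + R\<close> is the exponential of a polynomial near \<open>0\<close>, then \<open>L\<close>, hence
  \<open>U\<close>, has exponential moments of finite order, and \<open>z \<mapsto> E[exp (z U)]\<close> is entire, of finite order
  and without zeros, hence the exponential of a polynomial. Positivity (\<open>\<bar>E[exp (z U)]\<bar> \<le> E[exp (Re z U)]\<close>)
  forces degree at most \<open>2\<close>, so \<open>U\<close> is Gaussian or constant.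
\<close>

section \<open>Sums of ridge functions\<close>

text \<open>The ridge theorem separates only pairwise non-proportional directions. Noises whose
  coefficients in the two forms have the same ratio therefore reach it as one bundle, and the
  polynomial it yields belongs to the whole bundle. Passing from a bundle to a single member is a
  decomposition problem of Cramer type, and this is what brings in entire functions: an independent
  summand inherits exponential moments, and its Laplace transform is a factor of a zero-free
  function.

  The bundle is known only through the modulus of its characteristic function and only near
  \<open>0\<close>, so there is no analytic extension to start from. Derivatives at \<open>0\<close>
  are first turned into bounds on even moments, and these into bounds on exponential moments.

  In the model, the gain over plain independence is linearity: "for each noise, one of the two
  coefficients is \<open>0\<close>" survives linear combination of the second variable, so it passes
  from \<open>S\<close> and \<open>EZ\<close> to \<open>Z\<close>.\<close>

lemma pderiv_surj: "\<exists>P. pderiv P = (Q :: real poly)"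
proof
  have "pderiv (\<Sum>i\<le>degree Q. monom (coeff Q i / real (Suc i)) (Suc i))
      = (\<Sum>i\<le>degree Q. monom (coeff Q i) i)"
    by (simp add: higher_pderiv_sum[of 1, simplified] pderiv_monom del: of_nat_Suc)
  then show "pderiv (\<Sum>i\<le>degree Q. monom (coeff Q i / real (Suc i)) (Suc i)) = Q"
    by (simp add: poly_as_sum_of_monoms)
qed

lemma polynomial_antiderivative:
  fixes f :: "real \<Rightarrow> real"
  assumes "\<delta> > 0" and f: "\<And>t. \<bar>t\<bar> < \<delta> \<Longrightarrow> (f has_real_derivative poly Q t) (at t)"
  shows "\<exists>P. \<forall>t. \<bar>t\<bar> < \<delta> \<longrightarrow> f t = poly P t"
proof -
  obtain P where P: "pderiv P = Q" using pderiv_surj by blast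
  have "\<exists>c. \<forall>t\<in>{-\<delta><..<\<delta>}. f t - poly P t = c"
  proof (rule has_field_derivative_zero_constant)
    show "((\<lambda>t. f t - poly P t) has_real_derivative 0) (at x within {-\<delta><..<\<delta>})"
      if "x \<in> {-\<delta><..<\<delta>}" for x
    proof -
      have "((\<lambda>t. f t - poly P t) has_real_derivative (poly Q x - poly (pderiv P) x)) (at x)"
        using that by (intro DERIV_diff f poly_DERIV) auto
      then show ?thesis by (auto simp: P intro: DERIV_subset)
    qed
  qed simp
  then obtain c where c: "\<And>t. \<bar>t\<bar> < \<delta> \<Longrightarrow> f t - poly P t = c" by (auto simp: abs_less_iff)
  have "f t = poly (P + [:c:]) t" if "\<bar>t\<bar> < \<delta>" for t
    using c[OF that] by simp
  then show ?thesis by blast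
qed

text \<open>Integrating the relation along the direction on which \<open>d0\<close> vanishes expresses \<open>f d0\<close>
  through antiderivatives of the other summands, which gains one derivative.\<close>

lemma ridge_sum_imp_C1:
  fixes f :: "real \<times> real \<Rightarrow> real \<Rightarrow> real"
  assumes fin: "finite D" and d0: "d0 \<in> D" "d0 \<noteq> 0"
    and npar: "\<And>d. d \<in> D \<Longrightarrow> d \<noteq> d0 \<Longrightarrow> fst d0 * snd d - snd d0 * fst d \<noteq> 0"
    and \<delta>: "\<delta> > 0" and cont: "\<And>d t. d \<in> D \<Longrightarrow> \<bar>t\<bar> < \<delta> \<Longrightarrow> isCont (f d) t"
    and eq: "\<And>x y. \<bar>x\<bar> < \<delta> \<Longrightarrow> \<bar>y\<bar> < \<delta> \<Longrightarrow> (\<Sum>d\<in>D. f d (fst d * x + snd d * y)) = 0"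
  shows "\<exists>\<epsilon>>0. \<exists>f'. \<forall>t. \<bar>t\<bar> < \<epsilon> \<longrightarrow> (f d0 has_real_derivative f' t) (at t) \<and> isCont f' t"
proof -
  define n where "n = fst d0 ^ 2 + snd d0 ^ 2"
  have n: "n > 0"
    using d0(2) unfolding n_def by (metis prod_eq_iff sum_power2_gt_zero_iff fst_zero snd_zero)
  \<comment> \<open>New coordinates: \<open>x = fst d0 / n * u - snd d0 * v\<close> and
    \<open>y = snd d0 / n * u + fst d0 * v\<close>. In them direction \<open>d\<close> reads
    \<open>\<alpha> d * u + \<beta> d * v\<close>, and \<open>d0\<close> reads
    \<open>u\<close>.\<close>
  define \<alpha> where "\<alpha> d = (fst d0 * fst d + snd d0 * snd d) / n" for d
  define \<beta> where "\<beta> d = fst d0 * snd d - snd d0 * fst d" for d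
  define C where "C = 1 + \<bar>fst d0 / n\<bar> + \<bar>snd d0 / n\<bar> + \<bar>fst d0\<bar> + \<bar>snd d0\<bar> + (\<Sum>d\<in>D. \<bar>\<alpha> d\<bar> + \<bar>\<beta> d\<bar>)"
  have s0: "(\<Sum>d\<in>D. \<bar>\<alpha> d\<bar> + \<bar>\<beta> d\<bar>) \<ge> 0" by (intro sum_nonneg) auto
  have C: "C \<ge> 1" "\<bar>fst d0 / n\<bar> \<le> C" "\<bar>snd d0 / n\<bar> \<le> C" "\<bar>fst d0\<bar> \<le> C" "\<bar>snd d0\<bar> \<le> C"
    using s0 unfolding C_def by linarith+
  have CD: "\<bar>\<alpha> d\<bar> \<le> C" "\<bar>\<beta> d\<bar> \<le> C" if "d \<in> D" for d
  proof -
    have "\<bar>\<alpha> d\<bar> + \<bar>\<beta> d\<bar> \<le> (\<Sum>d\<in>D. \<bar>\<alpha> d\<bar> + \<bar>\<beta> d\<bar>)"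
      using fin that by (intro member_le_sum) auto
    then show "\<bar>\<alpha> d\<bar> \<le> C" "\<bar>\<beta> d\<bar> \<le> C" unfolding C_def by linarith+
  qed
  \<comment> \<open>\<open>C\<close> bounds every coefficient of the change of coordinates, so
    \<open>\<bar>u\<bar>, \<bar>v\<bar> < \<eta>\<close> keeps all arguments below
    \<open>2 * C * \<eta> = \<delta> / 2\<close>. The margin to \<open>\<delta>\<close> leaves a
    closed interval of continuity on which the antiderivatives \<open>F d\<close> live.\<close>
  define \<eta> where "\<eta> = \<delta> / (4 * C)"
  have \<eta>: "\<eta> > 0" using \<delta> C(1) by (simp add: \<eta>_def)
  have small: "\<bar>a * u + b * v\<bar> < \<delta> / 2" if "\<bar>a\<bar> \<le> C" "\<bar>b\<bar> \<le> C" "\<bar>u\<bar> < \<eta>" "\<bar>v\<bar> < \<eta>" for a b u v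
  proof -
    have "\<bar>a * u + b * v\<bar> \<le> C * \<bar>u\<bar> + C * \<bar>v\<bar>"
      using that by (intro order_trans[OF abs_triangle_ineq] add_mono) (auto simp: abs_mult intro!: mult_right_mono)
    also have "\<dots> < C * \<eta> + C * \<eta>" using that C(1) by (intro add_strict_mono mult_strict_left_mono) auto
    also have "\<dots> = \<delta> / 2" using C(1) by (simp add: \<eta>_def)
    finally show ?thesis .
  qed
  have key: "f d0 u + (\<Sum>d\<in>D - {d0}. f d (\<alpha> d * u + \<beta> d * v)) = 0"
    if u: "\<bar>u\<bar> < \<eta>" and v: "\<bar>v\<bar> < \<eta>" for u v
  proof -
    let ?x = "fst d0 / n * u + (- snd d0) * v" and ?y = "snd d0 / n * u + fst d0 * v"
    have "\<bar>?x\<bar> < \<delta>" "\<bar>?y\<bar> < \<delta>"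
      using small[of "fst d0 / n" "- snd d0" u v] small[of "snd d0 / n" "fst d0" u v] C u v \<delta> by auto
    then have "(\<Sum>d\<in>D. f d (fst d * ?x + snd d * ?y)) = 0" by (rule eq)
    moreover have "fst d * ?x + snd d * ?y = \<alpha> d * u + \<beta> d * v" for d
      using n by (simp add: \<alpha>_def \<beta>_def field_simps)
    moreover have "\<alpha> d0 = 1" "\<beta> d0 = 0" using n by (auto simp: \<alpha>_def \<beta>_def n_def power2_eq_square)
    ultimately show ?thesis using fin d0 by (simp add: sum.remove[of D d0])
  qed
  define F where "F d x = integral {-\<delta>/2..x} (f d)" for d x
  have F: "(F d has_real_derivative f d t) (at t)" if "d \<in> D" "\<bar>t\<bar> < \<delta> / 2" for d t
  proof -
    have "continuous_on {-\<delta>/2..\<delta>/2} (f d)"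
      using cont[OF that(1)] \<delta> by (intro continuous_at_imp_continuous_on) auto
    moreover have t: "- \<delta> / 2 < t" "t < \<delta> / 2" using that(2) by linarith+
    ultimately have "(F d has_real_derivative f d t) (at t within {-\<delta>/2..\<delta>/2})"
      unfolding F_def by (intro integral_has_real_derivative) auto
    then show ?thesis using at_within_Icc_at[OF t] by simp
  qed
  define h where "h = \<eta> / 2"
  have h: "0 < h" "h < \<eta>" using \<eta> by (auto simp: h_def)
  have int: "f d0 u = - (\<Sum>d\<in>D - {d0}. (F d (\<alpha> d * u + \<beta> d * h) - F d (\<alpha> d * u)) / \<beta> d) / h"
    if u: "\<bar>u\<bar> < \<eta>" for u
  proof -
    \<comment> \<open>\<open>G\<close> is the antiderivative in \<open>v\<close> of the left side of
      \<open>key\<close>, so it is constant; \<open>G h = G 0\<close> is the integrated relation.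
      Dividing by \<open>\<beta> d\<close> is possible because \<open>d\<close> is not parallel to
      \<open>d0\<close>.\<close>
    define G where "G v = v * f d0 u + (\<Sum>d\<in>D - {d0}. F d (\<alpha> d * u + \<beta> d * v) / \<beta> d)" for v
    have "(G has_real_derivative 0) (at v)" if v: "0 \<le> v" "v \<le> h" for v
    proof -
      have "((\<lambda>v. \<Sum>d\<in>D - {d0}. F d (\<alpha> d * u + \<beta> d * v) / \<beta> d) has_real_derivative
          (\<Sum>d\<in>D - {d0}. f d (\<alpha> d * u + \<beta> d * v) * \<beta> d / \<beta> d)) (at v)"
      proof (intro DERIV_sum DERIV_cdivide)
        fix d assume d: "d \<in> D - {d0}"
        show "((\<lambda>v. F d (\<alpha> d * u + \<beta> d * v)) has_real_derivative f d (\<alpha> d * u + \<beta> d * v) * \<beta> d) (at v)"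
          using d small[of "\<alpha> d" "\<beta> d" u v] u v h CD[of d]
          by (intro DERIV_chain2[OF F]) (auto intro!: derivative_eq_intros)
      qed
      then have "(G has_real_derivative (f d0 u + (\<Sum>d\<in>D - {d0}. f d (\<alpha> d * u + \<beta> d * v) * \<beta> d / \<beta> d))) (at v)"
        unfolding G_def by (rule DERIV_cong[OF DERIV_add[OF DERIV_cmult_right[OF DERIV_ident]]]) simp
      moreover have "(\<Sum>d\<in>D - {d0}. f d (\<alpha> d * u + \<beta> d * v) * \<beta> d / \<beta> d)
          = (\<Sum>d\<in>D - {d0}. f d (\<alpha> d * u + \<beta> d * v))"
        using npar by (intro sum.cong) (auto simp: \<beta>_def)
      ultimately show ?thesis using key[OF u, of v] v h by simp
    qed
    then have "G h = G 0"
      using h by (intro DERIV_isconst_end) (auto intro!: continuous_at_imp_continuous_on DERIV_isCont)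
    then have "f d0 u * h = - (\<Sum>d\<in>D - {d0}. (F d (\<alpha> d * u + \<beta> d * h) - F d (\<alpha> d * u)) / \<beta> d)"
      by (simp add: G_def sum_subtractf diff_divide_distrib mult.commute)
    then show ?thesis using h(1) by (subst eq_divide_eq) simp
  qed
  \<comment> \<open>The derivative of \<open>int\<close> in \<open>u\<close>. It contains only
    values of the continuous functions \<open>f d\<close>, hence is continuous itself.\<close>
  define f' where "f' u = - (\<Sum>d\<in>D - {d0}. (f d (\<alpha> d * u + \<beta> d * h) - f d (\<alpha> d * u)) * \<alpha> d / \<beta> d) / h" for u
  have "(f d0 has_real_derivative f' u) (at u) \<and> isCont f' u" if u: "\<bar>u\<bar> < \<eta>" for u
  proof
    have s: "\<bar>\<alpha> d * u + \<beta> d * h\<bar> < \<delta> / 2" "\<bar>\<alpha> d * u\<bar> < \<delta> / 2" if "d \<in> D" for d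
      using small[of "\<alpha> d" "\<beta> d" u h] small[of "\<alpha> d" "\<beta> d" u 0] CD[OF that] u h by auto
    have "((\<lambda>u. - (\<Sum>d\<in>D - {d0}. (F d (\<alpha> d * u + \<beta> d * h) - F d (\<alpha> d * u)) / \<beta> d) / h)
       has_real_derivative f' u) (at u)"
      unfolding f'_def
    proof (intro DERIV_cdivide DERIV_minus DERIV_sum)
      fix d assume d: "d \<in> D - {d0}"
      have "((\<lambda>u. F d (\<alpha> d * u + \<beta> d * h)) has_real_derivative f d (\<alpha> d * u + \<beta> d * h) * \<alpha> d) (at u)"
        using s[of d] d by (intro DERIV_chain2[OF F]) (auto intro!: derivative_eq_intros)
      moreover have "((\<lambda>u. F d (\<alpha> d * u)) has_real_derivative f d (\<alpha> d * u) * \<alpha> d) (at u)"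
        using s[of d] d by (intro DERIV_chain2[OF F]) (auto intro!: derivative_eq_intros)
      ultimately show "((\<lambda>u. F d (\<alpha> d * u + \<beta> d * h) - F d (\<alpha> d * u)) has_real_derivative
          (f d (\<alpha> d * u + \<beta> d * h) - f d (\<alpha> d * u)) * \<alpha> d) (at u)"
        by (auto intro!: derivative_eq_intros simp: algebra_simps)
    qed
    moreover have "\<forall>\<^sub>F u in nhds u. f d0 u = - (\<Sum>d\<in>D - {d0}. (F d (\<alpha> d * u + \<beta> d * h) - F d (\<alpha> d * u)) / \<beta> d) / h"
    proof -
      have "\<forall>\<^sub>F u in nhds u. u \<in> {-\<eta><..<\<eta>}" using u by (intro eventually_nhds_in_open) auto
      then show ?thesis by eventually_elim (rule int, auto)
    qed
    ultimately show "(f d0 has_real_derivative f' u) (at u)"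
      by (rule iffD2[OF DERIV_cong_ev[OF refl _ refl], rotated])
    have c: "isCont (\<lambda>u. f d (\<alpha> d * u + \<beta> d * h)) u" "isCont (\<lambda>u. f d (\<alpha> d * u)) u" if "d \<in> D" for d
    proof -
      have "\<bar>\<alpha> d * u + \<beta> d * h\<bar> < \<delta>" "\<bar>\<alpha> d * u\<bar> < \<delta>" using s[OF that] \<delta> by linarith+
      from this[THEN cont[OF that]] show "isCont (\<lambda>u. f d (\<alpha> d * u + \<beta> d * h)) u" "isCont (\<lambda>u. f d (\<alpha> d * u)) u"
        by (auto intro!: isCont_o2[of _ _ "f d"] continuous_intros)
    qed
    show "isCont f' u" unfolding f'_def
    proof (intro continuous_intros c)
      show "\<beta> d \<noteq> 0" if "d \<in> D - {d0}" for d using npar that by (auto simp: \<beta>_def)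
    qed (use h in auto)
  qed
  then show ?thesis using \<eta> by blast
qed

text \<open>Differentiating the relation along the direction on which \<open>d0\<close> vanishes removes the \<open>d0\<close>
  summand and leaves a relation of the same kind between the derivatives of the others.\<close>

theorem ridge_sum_imp_polynomial:
  fixes f :: "real \<times> real \<Rightarrow> real \<Rightarrow> real"
  assumes "finite D" and "0 \<notin> D"
    and "\<And>d e. d \<in> D \<Longrightarrow> e \<in> D \<Longrightarrow> d \<noteq> e \<Longrightarrow> fst d * snd e - snd d * fst e \<noteq> 0"
    and "\<delta> > 0" and "\<And>d t. d \<in> D \<Longrightarrow> \<bar>t\<bar> < \<delta> \<Longrightarrow> isCont (f d) t"
    and "\<And>x y. \<bar>x\<bar> < \<delta> \<Longrightarrow> \<bar>y\<bar> < \<delta> \<Longrightarrow> (\<Sum>d\<in>D. f d (fst d * x + snd d * y)) = 0"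
    and "d \<in> D"
  shows "\<exists>P. \<exists>\<epsilon>>0. \<forall>t. \<bar>t\<bar> < \<epsilon> \<longrightarrow> f d t = poly P t"
  using assms
proof (induction "card D" arbitrary: D f \<delta> d)
  case 0
  then show ?case by auto
next
  case (Suc m)
  note fin = Suc.prems(1) and nz = Suc.prems(2) and npar = Suc.prems(3) and \<delta> = Suc.prems(4)
    and cont = Suc.prems(5) and eq = Suc.prems(6) and d = Suc.prems(7)
  have C1: "\<exists>\<epsilon>>0. \<exists>f'. \<forall>t. \<bar>t\<bar> < \<epsilon> \<longrightarrow> (f e has_real_derivative f' t) (at t) \<and> isCont f' t"
    if "e \<in> D" for e
  proof (rule ridge_sum_imp_C1[where D = D and \<delta> = \<delta>])
    show "fst e * snd d - snd e * fst d \<noteq> 0" if "d \<in> D" "d \<noteq> e" for d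
      using npar[of e d] that \<open>e \<in> D\<close> by auto
  qed (use fin nz \<delta> cont eq that in auto)
  then obtain \<epsilon> f' where \<epsilon>: "\<And>e. e \<in> D \<Longrightarrow> \<epsilon> e > 0"
    and f': "\<And>e t. e \<in> D \<Longrightarrow> \<bar>t\<bar> < \<epsilon> e \<Longrightarrow> (f e has_real_derivative f' e t) (at t) \<and> isCont (f' e) t"
    by metis
  define \<epsilon>0 where "\<epsilon>0 = Min (insert \<delta> (\<epsilon> ` D))"
  have \<epsilon>0: "\<epsilon>0 > 0" "\<epsilon>0 \<le> \<delta>" "\<And>e. e \<in> D \<Longrightarrow> \<epsilon>0 \<le> \<epsilon> e"
    using fin \<epsilon> \<delta> by (auto simp: \<epsilon>0_def)
  show ?case
  proof (cases "D = {d}")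
    case True
    \<comment> \<open>With a single direction, the point
      \<open>(fst d / n * t, snd d / n * t)\<close> gives the argument \<open>t\<close>, so the
      relation says that \<open>f d\<close> vanishes near \<open>0\<close>.\<close>
    define n where "n = fst d ^ 2 + snd d ^ 2"
    have n: "n > 0"
      using nz d unfolding n_def by (metis prod_eq_iff sum_power2_gt_zero_iff fst_zero snd_zero)
    define C where "C = 1 + \<bar>fst d / n\<bar> + \<bar>snd d / n\<bar>"
    have C: "C > 0" by (simp add: C_def add_pos_nonneg)
    have "f d t = poly 0 t" if t: "\<bar>t\<bar> < \<delta> / C" for t
    proof -
      have "C * \<bar>t\<bar> < \<delta>" using t C by (simp add: field_simps)
      moreover have "\<bar>fst d / n\<bar> * \<bar>t\<bar> \<le> C * \<bar>t\<bar>" "\<bar>snd d / n\<bar> * \<bar>t\<bar> \<le> C * \<bar>t\<bar>"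
        unfolding C_def by (intro mult_right_mono; linarith?; simp)+
      ultimately have "\<bar>fst d / n * t\<bar> < \<delta>" "\<bar>snd d / n * t\<bar> < \<delta>"
        unfolding abs_mult by linarith+
      from eq[OF this] have "f d (fst d * (fst d / n * t) + snd d * (snd d / n * t)) = 0"
        unfolding True by simp
      moreover have "fst d * (fst d / n * t) + snd d * (snd d / n * t) = t"
      proof -
        have "fst d * (fst d / n * t) + snd d * (snd d / n * t) = t * n / n"
          by (simp add: n_def power2_eq_square algebra_simps add_divide_distrib)
        then show ?thesis using n by simp
      qed
      ultimately show ?thesis by simp
    qed
    then show ?thesis using \<delta> C by (intro exI[of _ 0] exI[of _ "\<delta> / C"]) auto
  next
    case False
    \<comment> \<open>The direction to be eliminated must differ from \<open>d\<close>, so that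
      \<open>d\<close> survives into the smaller relation.\<close>
    then obtain d0 where d0: "d0 \<in> D" "d0 \<noteq> d" using d by auto
    define \<beta> where "\<beta> e = fst d0 * snd e - snd d0 * fst e" for e
    define C where "C = 1 + (\<Sum>e\<in>D. \<bar>fst e\<bar> + \<bar>snd e\<bar>)"
    have C1: "C \<ge> 1" unfolding C_def by (simp add: sum_nonneg)
    have C: "\<bar>fst e\<bar> + \<bar>snd e\<bar> \<le> C" if "e \<in> D" for e
    proof -
      have "\<bar>fst e\<bar> + \<bar>snd e\<bar> \<le> (\<Sum>e\<in>D. \<bar>fst e\<bar> + \<bar>snd e\<bar>)"
        using fin that by (intro member_le_sum) auto
      then show ?thesis by (simp add: C_def)
    qed
    define \<eta> where "\<eta> = \<epsilon>0 / C"
    have \<eta>: "\<eta> > 0" "\<eta> \<le> \<epsilon>0" using \<epsilon>0 C1 by (auto simp: \<eta>_def field_simps)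
    have small: "\<bar>fst e * x + snd e * y\<bar> < \<epsilon>0" if "e \<in> D" "\<bar>x\<bar> < \<eta>" "\<bar>y\<bar> < \<eta>" for e x y
    proof -
      let ?m = "max \<bar>x\<bar> \<bar>y\<bar>"
      have "\<bar>fst e * x + snd e * y\<bar> \<le> \<bar>fst e\<bar> * ?m + \<bar>snd e\<bar> * ?m"
        by (intro order_trans[OF abs_triangle_ineq] add_mono) (auto simp: abs_mult intro!: mult_left_mono)
      also have "\<dots> \<le> C * ?m" using C[OF that(1)] by (auto simp flip: distrib_right intro!: mult_right_mono)
      also have "\<dots> < C * \<eta>" using C1 that by (intro mult_strict_left_mono) auto
      finally show ?thesis using C1 by (simp add: \<eta>_def)
    qed
    have eq': "(\<Sum>e\<in>D - {d0}. \<beta> e * f' e (fst e * x + snd e * y)) = 0" if x: "\<bar>x\<bar> < \<eta>" and y: "\<bar>y\<bar> < \<eta>" for x y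
    proof -
      \<comment> \<open>The point moves along \<open>(- snd d0, fst d0)\<close>; the argument of
        \<open>f e\<close> then changes at the rate \<open>\<beta> e\<close>, which is
        \<open>0\<close> for \<open>d0\<close>.\<close>
      define g where "g s = (\<Sum>e\<in>D. f e (fst e * (x - s * snd d0) + snd e * (y + s * fst d0)))" for s
      have "(g has_real_derivative (\<Sum>e\<in>D. f' e (fst e * x + snd e * y) * \<beta> e)) (at 0)"
        unfolding g_def
      proof (intro DERIV_sum)
        fix e assume e: "e \<in> D"
        show "((\<lambda>s. f e (fst e * (x - s * snd d0) + snd e * (y + s * fst d0))) has_real_derivative
          f' e (fst e * x + snd e * y) * \<beta> e) (at 0)"
          using f'[OF e, of "fst e * x + snd e * y"] small[OF e x y] \<epsilon>0(3)[OF e]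
          by (intro DERIV_chain2[of "f e"]) (auto intro!: derivative_eq_intros simp: \<beta>_def)
      qed
      moreover have "\<forall>\<^sub>F s in nhds 0. g s = 0"
      proof -
        let ?S = "{s. \<bar>x - s * snd d0\<bar> < \<delta>} \<inter> {s. \<bar>y + s * fst d0\<bar> < \<delta>}"
        have "open ?S" by (intro open_Int open_Collect_less continuous_intros)
        then have "\<forall>\<^sub>F s in nhds 0. s \<in> ?S"
          using x y \<eta> \<epsilon>0 by (intro eventually_nhds_in_open) auto
        then show ?thesis by eventually_elim (auto simp: g_def intro!: eq)
      qed
      then have "(g has_real_derivative 0) (at 0)"
        using DERIV_cong_ev[of 0 0 g "\<lambda>_. 0" 0 0] by simp
      ultimately have "(\<Sum>e\<in>D. f' e (fst e * x + snd e * y) * \<beta> e) = 0" by (rule DERIV_unique)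
      moreover have "\<beta> d0 = 0" by (simp add: \<beta>_def)
      ultimately show ?thesis using fin d0 by (simp add: sum.remove[of D d0] mult.commute)
    qed
    \<comment> \<open>The weights \<open>\<beta> e\<close> are absorbed into the functions to match
      the induction hypothesis. Since \<open>\<beta> d\<close> is nonzero, it can be divided out
      again before integrating.\<close>
    have "\<exists>P. \<exists>\<epsilon>>0. \<forall>t. \<bar>t\<bar> < \<epsilon> \<longrightarrow> (\<lambda>t. \<beta> d * f' d t) t = poly P t"
    proof (rule Suc.hyps(1)[of "D - {d0}" \<eta> "\<lambda>e t. \<beta> e * f' e t"])
      show "isCont (\<lambda>t. \<beta> e * f' e t) t" if "e \<in> D - {d0}" "\<bar>t\<bar> < \<eta>" for e t
        using f'[of e t] \<epsilon>0(3)[of e] \<eta> that by (intro continuous_intros) auto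
    qed (use Suc.hyps(2) fin nz npar d0 d \<eta> eq' in auto)
    then obtain P r where r: "r > 0" and P: "\<And>t. \<bar>t\<bar> < r \<Longrightarrow> \<beta> d * f' d t = poly P t" by auto
    have \<beta>d: "\<beta> d \<noteq> 0" using npar[of d0 d] d0 d by (simp add: \<beta>_def)
    have "\<exists>P. \<forall>t. \<bar>t\<bar> < min r \<epsilon>0 \<longrightarrow> f d t = poly P t"
    proof (rule polynomial_antiderivative)
      show "(f d has_real_derivative poly (Polynomial.smult (1 / \<beta> d) P) t) (at t)" if "\<bar>t\<bar> < min r \<epsilon>0" for t
        using f'[OF d, of t] P[of t] \<epsilon>0(3)[OF d] that \<beta>d by (simp add: field_simps flip: P)
    qed (use r \<epsilon>0 in auto)
    then show ?thesis using r \<epsilon>0 by (metis min_less_iff_conj)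
  qed
qed

section \<open>Exponential moments from the characteristic function near the origin\<close>

text \<open>The polynomial factor of the \<open>n\<close>-th derivative of \<open>exp P\<close>,
  that is, a complete Bell polynomial in the derivatives of \<open>P\<close>.\<close>

primrec exp_poly_deriv :: "real poly \<Rightarrow> nat \<Rightarrow> real poly" where
  "exp_poly_deriv P 0 = 1"
| "exp_poly_deriv P (Suc n) = pderiv (exp_poly_deriv P n) + pderiv P * exp_poly_deriv P n"

lemma DERIV_exp_poly_deriv:
  "((\<lambda>t. poly (exp_poly_deriv P n) t * exp (poly P t)) has_real_derivative
     poly (exp_poly_deriv P (Suc n)) t * exp (poly P t)) (at t)"
  by (auto intro!: derivative_eq_intros poly_DERIV simp: algebra_simps)

text \<open>The recursion uses only sums, products and \<open>pderiv\<close>, all of which have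
  nonnegative structure constants, so taking absolute values of the coefficients of \<open>P\<close>
  can only enlarge the result.\<close>

lemma abs_coeff_exp_poly_deriv:
  "\<bar>coeff (exp_poly_deriv P n) i\<bar> \<le> coeff (exp_poly_deriv (map_poly abs P) n) i"
proof (induction n arbitrary: i)
  case 0
  then show ?case by (simp add: coeff_1)
next
  case (Suc n)
  let ?Q = "exp_poly_deriv P n" and ?Q' = "exp_poly_deriv (map_poly abs P) n"
  have "\<bar>coeff (pderiv ?Q) i\<bar> \<le> coeff (pderiv ?Q') i"
    using Suc.IH[of "Suc i"] by (simp add: coeff_pderiv abs_mult mult_left_mono del: of_nat_Suc)
  moreover have "\<bar>coeff (pderiv P * ?Q) i\<bar> \<le> coeff (pderiv (map_poly abs P) * ?Q') i"
  proof -
    have "\<bar>coeff (pderiv P * ?Q) i\<bar> \<le> (\<Sum>k\<le>i. \<bar>coeff (pderiv P) k * coeff ?Q (i - k)\<bar>)"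
      unfolding coeff_mult by (rule sum_abs)
    also have "\<dots> \<le> (\<Sum>k\<le>i. coeff (pderiv (map_poly abs P)) k * coeff ?Q' (i - k))"
    proof (rule sum_mono)
      fix k
      have "coeff (pderiv (map_poly abs P)) k = \<bar>coeff (pderiv P) k\<bar>"
        by (simp add: coeff_pderiv coeff_map_poly abs_mult del: of_nat_Suc)
      then show "\<bar>coeff (pderiv P) k * coeff ?Q (i - k)\<bar> \<le> coeff (pderiv (map_poly abs P)) k * coeff ?Q' (i - k)"
        using Suc.IH[of "i - k"] by (simp add: abs_mult mult_left_mono)
    qed
    finally show ?thesis by (simp add: coeff_mult)
  qed
  ultimately show ?case by simp
qed

lemma poly_nonneg_coeffs_nonneg:
  assumes "\<And>i. coeff P i \<ge> (0::real)" "t \<ge> 0" shows "poly P t \<ge> 0"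
  unfolding poly_altdef using assms by (intro sum_nonneg mult_nonneg_nonneg) auto

text \<open>Taylor's formula for the majorant \<open>exp (\<Sum>\<bar>p\<^sub>i\<bar> t\<^sup>i)\<close> has a nonnegative remainder.\<close>

lemma sum_exp_poly_deriv_le:
  assumes y: "y \<ge> 0"
  shows "(\<Sum>m<N. \<bar>poly (exp_poly_deriv P m) 0 * exp (poly P 0)\<bar> / fact m * y ^ m)
    \<le> exp (poly (map_poly abs P) y)"
proof -
  define Pa where "Pa = map_poly abs P"
  define F where "F n t = poly (exp_poly_deriv Pa n) t * exp (poly Pa t)" for n t
  have co: "coeff (exp_poly_deriv Pa n) i \<ge> 0" for n i
    using abs_coeff_exp_poly_deriv[of P n i] unfolding Pa_def by linarith
  have le: "\<bar>poly (exp_poly_deriv P m) 0 * exp (poly P 0)\<bar> \<le> F m 0" for m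
  proof -
    have "\<bar>poly (exp_poly_deriv P m) 0\<bar> \<le> poly (exp_poly_deriv Pa m) 0"
      using abs_coeff_exp_poly_deriv[of P m 0] by (simp add: poly_0_coeff_0 Pa_def)
    moreover have "poly P 0 \<le> poly Pa 0" by (simp add: poly_0_coeff_0 Pa_def coeff_map_poly)
    ultimately show ?thesis unfolding F_def abs_mult by (intro mult_mono) auto
  qed
  have "(\<Sum>m<N. F m 0 / fact m * y ^ m) \<le> F 0 y"
  \<comment> \<open>Taylor's formula with remainder at an interior point needs \<open>y > 0\<close>
    and \<open>N > 0\<close>; the degenerate cases are direct.\<close>
  proof (cases "y = 0 \<or> N = 0")
    case True
    have nn: "F 0 0 \<ge> 0" "F 0 y \<ge> 0" by (auto simp: F_def)
    show ?thesis
    proof (cases N)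
      case (Suc k)
      then have "y = 0" using True by simp
      moreover have "(\<Sum>m<Suc k. F m 0 / fact m * 0 ^ m) = F 0 0"
        by (simp only: sum.lessThan_Suc_shift) simp
      ultimately show ?thesis using Suc by simp
    qed (use nn in simp)
  next
    case False
    then have "\<exists>t>0. t < y \<and> F 0 y = (\<Sum>m<N. F m 0 / fact m * y ^ m) + F N t / fact N * y ^ N"
      using y unfolding F_def by (intro Maclaurin) (auto intro!: DERIV_exp_poly_deriv[simplified])
    then obtain t where t: "t > 0" "F 0 y = (\<Sum>m<N. F m 0 / fact m * y ^ m) + F N t / fact N * y ^ N" by blast
    have "F N t \<ge> 0" unfolding F_def using t co by (intro mult_nonneg_nonneg poly_nonneg_coeffs_nonneg) auto
    then show ?thesis using t y by simp
  qed
  moreover have "(\<Sum>m<N. \<bar>poly (exp_poly_deriv P m) 0 * exp (poly P 0)\<bar> / fact m * y ^ m) \<le> (\<Sum>m<N. F m 0 / fact m * y ^ m)"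
    using le y by (intro sum_mono mult_right_mono divide_right_mono) auto
  ultimately show ?thesis by (simp add: F_def Pa_def)
qed

text \<open>Sign and scaling are chosen so that \<open>\<lambda>t. cos (t * w)\<close> is an
  eigenfunction with eigenvalue \<open>(2 - 2 * cos (h * w)) / h^2\<close>, which is nonnegative and
  approximates \<open>w^2\<close>.\<close>

definition neg_second_diff :: "real \<Rightarrow> (real \<Rightarrow> real) \<Rightarrow> real \<Rightarrow> real" where
  "neg_second_diff h f t = (2 * f t - f (t + h) - f (t - h)) / h\<^sup>2"

lemma neg_second_diff_power_Suc:
  "(neg_second_diff h ^^ Suc n) f t = (2 * (neg_second_diff h ^^ n) f t
     - (neg_second_diff h ^^ n) f (t + h) - (neg_second_diff h ^^ n) f (t - h)) / h\<^sup>2"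
  unfolding funpow.simps o_apply by (rule neg_second_diff_def)

text \<open>The \<open>n\<close>-fold difference only sees points within
  \<open>n * \<bar>h\<bar>\<close> of \<open>t\<close>. Knowing the characteristic function near
  \<open>0\<close> is therefore enough for small \<open>h\<close>.\<close>

lemma neg_second_diff_power_cong:
  assumes "\<And>s. \<bar>s - t\<bar> \<le> real n * \<bar>h\<bar> \<Longrightarrow> f s = g s"
  shows "(neg_second_diff h ^^ n) f t = (neg_second_diff h ^^ n) g t"
  using assms
proof (induction n arbitrary: t)
  case 0
  then show ?case by simp
next
  case (Suc n)
  have "(neg_second_diff h ^^ n) f s = (neg_second_diff h ^^ n) g s" if "s \<in> {t, t + h, t - h}" for s
  proof (rule Suc.IH)
    fix r assume "\<bar>r - s\<bar> \<le> real n * \<bar>h\<bar>"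
    then show "f r = g r" using that by (intro Suc.prems) (auto simp: algebra_simps)
  qed
  then show ?case by (simp add: neg_second_diff_power_Suc del: funpow.simps)
qed

lemma DERIV_neg_second_diff_power:
  assumes "\<And>m t. (F m has_real_derivative F (Suc m) t) (at t)"
  shows "((neg_second_diff h ^^ n) (F m) has_real_derivative (neg_second_diff h ^^ n) (F (Suc m)) t) (at t)"
proof (induction n arbitrary: m t)
  case 0
  then show ?case using assms by simp
next
  case (Suc n)
  let ?G = "\<lambda>m. (neg_second_diff h ^^ n) (F m)"
  have "((\<lambda>t. ?G m (t + h)) has_real_derivative ?G (Suc m) (t + h)) (at t)"
    using Suc.IH[of m "t + h"] by (simp add: DERIV_shift)
  moreover have "((\<lambda>t. ?G m (t - h)) has_real_derivative ?G (Suc m) (t - h)) (at t)"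
    using Suc.IH[of m "t - h"] DERIV_shift[of "?G m" _ t "- h"] by simp
  ultimately show ?case
    unfolding neg_second_diff_power_Suc
    by (intro DERIV_cdivide DERIV_diff DERIV_cmult Suc.IH)
qed

text \<open>In \<open>f (t + s) + f (t - s)\<close> the first-order terms cancel, and Taylor's
  formula turns the second difference into minus the mean of two values of \<open>f''\<close> within
  distance \<open>h\<close> of \<open>t\<close>.\<close>

lemma abs_neg_second_diff_le:
  assumes h: "h > 0"
    and f': "\<And>t. (f has_real_derivative f' t) (at t)" and f'': "\<And>t. (f' has_real_derivative f'' t) (at t)"
    and B: "\<And>s. \<bar>s - t\<bar> \<le> h \<Longrightarrow> \<bar>f'' s\<bar> \<le> B"
  shows "\<bar>neg_second_diff h f t\<bar> \<le> B"
proof -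
  define g where "g m = (if m = 0 then (\<lambda>s. f (t + s) + f (t - s)) else if m = Suc 0 then (\<lambda>s. f' (t + s) - f' (t - s))
     else (\<lambda>s. f'' (t + s) + f'' (t - s)))" for m :: nat
  have f1: "((\<lambda>s. f (t + s)) has_real_derivative f' (t + s)) (at s)"
      "((\<lambda>s. f (t - s)) has_real_derivative - f' (t - s)) (at s)"
      "((\<lambda>s. f' (t + s)) has_real_derivative f'' (t + s)) (at s)"
      "((\<lambda>s. f' (t - s)) has_real_derivative - f'' (t - s)) (at s)" for s
    using DERIV_chain2[OF f' DERIV_add[OF DERIV_const[of t] DERIV_ident], of s UNIV]
      DERIV_chain2[OF f' DERIV_diff[OF DERIV_const[of t] DERIV_ident], of s UNIV]
      DERIV_chain2[OF f'' DERIV_add[OF DERIV_const[of t] DERIV_ident], of s UNIV]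
      DERIV_chain2[OF f'' DERIV_diff[OF DERIV_const[of t] DERIV_ident], of s UNIV]
    by simp_all
  have d0: "(g 0 has_real_derivative g (Suc 0) s) (at s)" for s
    using DERIV_add[OF f1(1,2)] by (simp add: g_def)
  have d1: "(g (Suc 0) has_real_derivative g 2 s) (at s)" for s
    using DERIV_diff[OF f1(3,4)] by (simp add: g_def)
  have "\<exists>s>0. s < h \<and> g 0 h = (\<Sum>m<2. g m 0 / fact m * h ^ m) + g 2 s / fact 2 * h ^ 2"
  proof (rule Maclaurin[OF h])
    show "\<forall>m s. m < 2 \<and> 0 \<le> s \<and> s \<le> h \<longrightarrow> (g m has_real_derivative g (Suc m) s) (at s)"
      using d0 d1 by (auto simp: less_Suc_eq numeral_2_eq_2)
  qed auto
  then obtain s where s: "0 < s" "s < h" "g 0 h = (\<Sum>m<2. g m 0 / fact m * h ^ m) + g 2 s / fact 2 * h ^ 2"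
    by blast
  have "f (t + h) + f (t - h) = 2 * f t + (f'' (t + s) + f'' (t - s)) / 2 * h ^ 2"
    using s(3) by (simp add: g_def numeral_2_eq_2)
  then have "neg_second_diff h f t = - (f'' (t + s) + f'' (t - s)) / 2"
    using h by (simp add: neg_second_diff_def field_simps)
  then show ?thesis using B[of "t + s"] B[of "t - s"] s by (auto simp: abs_if split: if_splits)
qed

text \<open>Differences commute with derivatives, so each difference can be traded for two
  derivatives. Stating it for a whole sequence \<open>F\<close> of successive derivatives lets the
  induction shift \<open>F\<close> by two.\<close>

lemma abs_neg_second_diff_power_le:
  assumes F: "\<And>m t. (F m has_real_derivative F (Suc m) t) (at t)" and h: "h > 0"
    and B: "\<And>s. \<bar>s - t\<bar> \<le> real n * h \<Longrightarrow> \<bar>F (2 * n) s\<bar> \<le> B"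
  shows "\<bar>(neg_second_diff h ^^ n) (F 0) t\<bar> \<le> B"
  using F B
proof (induction n arbitrary: F t)
  case 0
  then show ?case by simp
next
  case (Suc n)
  let ?G = "\<lambda>m. (neg_second_diff h ^^ n) (F m)"
  have "\<bar>neg_second_diff h (?G 0) t\<bar> \<le> B"
  proof (rule abs_neg_second_diff_le[OF h])
    show "(?G 0 has_real_derivative ?G (Suc 0) t) (at t)" for t
      by (rule DERIV_neg_second_diff_power[of F, OF Suc.prems(1)])
    show "(?G (Suc 0) has_real_derivative ?G (Suc (Suc 0)) t) (at t)" for t
      by (rule DERIV_neg_second_diff_power[of F, OF Suc.prems(1)])
    fix s assume s: "\<bar>s - t\<bar> \<le> h"
    show "\<bar>?G (Suc (Suc 0)) s\<bar> \<le> B"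
    proof (rule Suc.IH[of "\<lambda>m. F (Suc (Suc m))"])
      fix r assume "\<bar>r - s\<bar> \<le> real n * h"
      then show "\<bar>F (Suc (Suc (2 * n))) r\<bar> \<le> B"
        using Suc.prems(2)[of r] s by (simp add: algebra_simps)
    qed (rule Suc.prems(1))
  qed
  then show ?case by simp
qed

section \<open>Moments and exponential moments from iterated differences\<close>

context prob_space
begin

text \<open>The identity \<open>2 cos (t w) - cos ((t + h) w) - cos ((t - h) w) = (2 - 2 cos (h w))
  cos (t w)\<close>, iterated under the expectation. The multiplier is at most
  \<open>4 / h^2\<close>, so every integrand is bounded and no moment of \<open>W\<close> is
  presupposed.\<close>

lemma neg_second_diff_power_expectation_cos:
  assumes [measurable]: "W \<in> borel_measurable M"
  shows "(neg_second_diff h ^^ n) (\<lambda>t. expectation (\<lambda>x. cos (t * W x))) t =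
    expectation (\<lambda>x. ((2 - 2 * cos (h * W x)) / h\<^sup>2) ^ n * cos (t * W x))"
proof (induction n arbitrary: t)
  case 0
  then show ?case by simp
next
  case (Suc n)
  define K where "K x = (2 - 2 * cos (h * W x)) / h\<^sup>2" for x
  have K: "\<bar>K x\<bar> \<le> 4 / h\<^sup>2" for x
  proof -
    have "\<bar>2 - 2 * cos (h * W x)\<bar> \<le> 4" using cos_le_one[of "h * W x"] cos_ge_minus_one[of "h * W x"]
      by linarith
    then show ?thesis unfolding K_def by (simp add: abs_divide divide_right_mono)
  qed
  have [measurable]: "K \<in> borel_measurable M" unfolding K_def by measurable
  have int: "integrable M (\<lambda>x. K x ^ n * cos (s * W x))" for s
  proof (rule integrable_const_bound[of _ "(4 / h\<^sup>2) ^ n"])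
    show "AE x in M. norm (K x ^ n * cos (s * W x)) \<le> (4 / h\<^sup>2) ^ n"
    proof (rule AE_I2)
      fix x
      have "\<bar>K x\<bar> ^ n * \<bar>cos (s * W x)\<bar> \<le> (4 / h\<^sup>2) ^ n * 1"
        using K by (intro mult_mono power_mono) auto
      then show "norm (K x ^ n * cos (s * W x)) \<le> (4 / h\<^sup>2) ^ n" by (simp add: abs_mult power_abs)
    qed
  qed measurable
  have "(neg_second_diff h ^^ Suc n) (\<lambda>t. expectation (\<lambda>x. cos (t * W x))) t
    = (2 * expectation (\<lambda>x. K x ^ n * cos (t * W x)) - expectation (\<lambda>x. K x ^ n * cos ((t + h) * W x))
         - expectation (\<lambda>x. K x ^ n * cos ((t - h) * W x))) / h\<^sup>2"
    by (simp only: Suc.IH neg_second_diff_power_Suc K_def)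
  also have "\<dots> = expectation (\<lambda>x. (2 * (K x ^ n * cos (t * W x)) - K x ^ n * cos ((t + h) * W x)
         - K x ^ n * cos ((t - h) * W x)) / h\<^sup>2)"
    using int by simp
  also have "\<dots> = expectation (\<lambda>x. K x ^ Suc n * cos (t * W x))"
    by (rule Bochner_Integration.integral_cong)
       (auto simp: K_def cos_add cos_diff algebra_simps diff_divide_distrib add_divide_distrib)
  finally show ?case by (simp add: K_def)
qed

text \<open>Fatou's lemma: \<open>((2 - 2 cos (hW)) / h\<^sup>2)\<^sup>n\<close> tends to \<open>W\<^bsup>2n\<^esup>\<close>, and its expectation is an iterated second
  difference of the characteristic function at \<open>0\<close>.\<close>

lemma even_moment_le:
  assumes [measurable]: "W \<in> borel_measurable M" and \<epsilon>: "\<epsilon> > 0"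
    and P: "\<And>t. \<bar>t\<bar> < \<epsilon> \<Longrightarrow> expectation (\<lambda>x. cos (t * W x)) = exp (poly P t)"
  shows "(\<integral>\<^sup>+x. ennreal (W x ^ (2 * n)) \<partial>M) \<le> ennreal \<bar>poly (exp_poly_deriv P (2 * n)) 0 * exp (poly P 0)\<bar>"
    (is "_ \<le> ennreal ?B")
proof (rule ennreal_le_epsilon)
  fix e :: real assume e: "e > 0"
  define F where "F m t = poly (exp_poly_deriv P m) t * exp (poly P t)" for m t
  have F: "(F m has_real_derivative F (Suc m) t) (at t)" for m t
    unfolding F_def by (rule DERIV_exp_poly_deriv)
  \<comment> \<open>The difference operator is controlled by derivatives in a neighbourhood, whereas
    the claim has the derivative at \<open>0\<close>; continuity closes the gap at the price of
    \<open>e\<close>.\<close>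
  have "isCont (\<lambda>s. \<bar>F (2 * n) s\<bar>) 0"
    using F by (intro continuous_intros DERIV_isCont)
  then have "\<forall>\<^sub>F s in at 0. \<bar>F (2 * n) s\<bar> < ?B + e"
    using e unfolding isCont_def by (intro order_tendstoD(2)) (auto simp: F_def)
  then obtain d where d: "d > 0" "\<And>s. s \<noteq> 0 \<Longrightarrow> \<bar>s\<bar> < d \<Longrightarrow> \<bar>F (2 * n) s\<bar> < ?B + e"
    by (auto simp: eventually_at)
  then have d': "\<bar>F (2 * n) s\<bar> \<le> ?B + e" if "\<bar>s\<bar> < d" for s
    using that e by (cases "s = 0") (auto simp: F_def less_imp_le)
  \<comment> \<open>A null sequence with \<open>n * h j < min d \<epsilon>\<close>: all points seen
    by the \<open>n\<close>-fold difference stay where both the formula for the characteristic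
    function and the derivative bound hold. The factor \<open>n + 1\<close> also covers
    \<open>n = 0\<close>.\<close>
  define h where "h j = min d \<epsilon> / (real (n + 1) * real (j + 1))" for j :: nat
  have h: "h j > 0" "real n * h j < min d \<epsilon>" for j
  proof -
    show "h j > 0" using d \<epsilon> by (simp add: h_def)
    have "real n * h j = min d \<epsilon> * (real n / (real (n + 1) * real (j + 1)))" by (simp add: h_def)
    also have "\<dots> < min d \<epsilon> * 1"
    proof (rule mult_strict_left_mono)
      have "real n < real (n + 1) * 1" by simp
      also have "\<dots> \<le> real (n + 1) * real (j + 1)" by (rule mult_left_mono) auto
      finally show "real n / (real (n + 1) * real (j + 1)) < 1" by (simp add: field_simps)
    qed (use d \<epsilon> in auto)
    finally show "real n * h j < min d \<epsilon>" by simp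
  qed
  have h0: "h \<longlonglongrightarrow> 0"
  proof -
    have "(\<lambda>j. min d \<epsilon> / real (n + 1) * inverse (real (Suc j))) \<longlonglongrightarrow> min d \<epsilon> / real (n + 1) * 0"
      by (intro tendsto_intros LIMSEQ_inverse_real_of_nat)
    moreover have "(\<lambda>j. min d \<epsilon> / real (n + 1) * inverse (real (Suc j))) = h"
      by (simp add: h_def fun_eq_iff divide_inverse)
    ultimately show ?thesis by (simp only: mult_zero_right)
  qed
  define K where "K j x = ((2 - 2 * cos (h j * W x)) / (h j)\<^sup>2) ^ n" for j x
  have K0: "K j x \<ge> 0" for j x by (simp add: K_def)
  have [measurable]: "K j \<in> borel_measurable M" for j unfolding K_def by measurable
  \<comment> \<open>By the half-angle formula the multiplier is
    \<open>4 * (sin (W x / 2 * h) / h)^2\<close>, and the inner quotient is a difference quotient at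
    \<open>0\<close>.\<close>
  have lim: "(\<lambda>j. K j x) \<longlonglongrightarrow> W x ^ (2 * n)" for x
  proof -
    have "((\<lambda>t. sin (W x / 2 * t)) has_real_derivative W x / 2) (at 0)"
      by (auto intro!: derivative_eq_intros)
    then have "(\<lambda>t. sin (W x / 2 * t) / t) \<midarrow>0\<rightarrow> W x / 2" by (simp add: DERIV_def)
    moreover have "filterlim h (at 0) sequentially"
      using h0 h(1) by (auto simp: filterlim_at intro!: always_eventually less_imp_neq[symmetric])
    ultimately have "(\<lambda>j. sin (W x / 2 * h j) / h j) \<longlonglongrightarrow> W x / 2"
      by (rule filterlim_compose)
    then have "(\<lambda>j. (4 * (sin (W x / 2 * h j) / h j)\<^sup>2) ^ n) \<longlonglongrightarrow> (4 * (W x / 2)\<^sup>2) ^ n"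
      by (intro tendsto_power tendsto_mult tendsto_const)
    moreover have "4 * (sin (W x / 2 * h j) / h j)\<^sup>2 = (2 - 2 * cos (h j * W x)) / (h j)\<^sup>2" for j
      using cos_double_sin[of "W x / 2 * h j"] by (simp add: power_divide mult.commute)
    moreover have "(4 * (W x / 2)\<^sup>2) ^ n = W x ^ (2 * n)" by (simp add: power_divide power_mult)
    ultimately show ?thesis by (simp only: K_def)
  qed
  have E: "(\<integral>\<^sup>+x. ennreal (K j x) \<partial>M) \<le> ennreal (?B + e)" for j
  proof -
    have "expectation (K j) = (neg_second_diff (h j) ^^ n) (\<lambda>t. expectation (\<lambda>x. cos (t * W x))) 0"
      by (simp add: neg_second_diff_power_expectation_cos K_def[abs_def])
    also have "\<dots> = (neg_second_diff (h j) ^^ n) (F 0) 0"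
    proof (rule neg_second_diff_power_cong)
      fix s assume "\<bar>s - 0\<bar> \<le> real n * \<bar>h j\<bar>"
      then have "\<bar>s\<bar> < \<epsilon>" using h[of j] by simp
      then show "expectation (\<lambda>x. cos (s * W x)) = F 0 s" using P by (simp add: F_def)
    qed
    also have "\<dots> \<le> ?B + e"
    proof -
      have "\<bar>F (2 * n) s\<bar> \<le> ?B + e" if "\<bar>s - 0\<bar> \<le> real n * h j" for s
        using d'[of s] that h(2)[of j] by simp
      from abs_neg_second_diff_power_le[OF F h(1) this] show ?thesis by (simp add: abs_le_iff)
    qed
    finally have "expectation (K j) \<le> ?B + e" .
    moreover have "integrable M (K j)"
    proof (rule integrable_const_bound[of _ "(4 / (h j)\<^sup>2) ^ n"])
      have "2 - 2 * cos (h j * W x) \<le> 4" for x using cos_ge_minus_one[of "h j * W x"] by linarith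
      then have "K j x \<le> (4 / (h j)\<^sup>2) ^ n" for x
        unfolding K_def by (intro power_mono divide_right_mono) auto
      then show "AE x in M. norm (K j x) \<le> (4 / (h j)\<^sup>2) ^ n" using K0 by simp
    qed measurable
    then have "(\<integral>\<^sup>+x. ennreal (K j x) \<partial>M) = ennreal (expectation (K j))"
      using K0 by (intro nn_integral_eq_integral) auto
    ultimately show ?thesis by (simp only: ennreal_leI)
  qed
  have "(\<integral>\<^sup>+x. ennreal (W x ^ (2 * n)) \<partial>M) = (\<integral>\<^sup>+x. liminf (\<lambda>j. ennreal (K j x)) \<partial>M)"
  proof (rule nn_integral_cong)
    fix x
    have "(\<lambda>j. ennreal (K j x)) \<longlonglongrightarrow> ennreal (W x ^ (2 * n))" using lim by (rule tendsto_ennrealI)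
    then show "ennreal (W x ^ (2 * n)) = liminf (\<lambda>j. ennreal (K j x))"
      by (simp add: lim_imp_Liminf)
  qed
  also have "\<dots> \<le> liminf (\<lambda>j. \<integral>\<^sup>+x. ennreal (K j x) \<partial>M)"
    by (rule nn_integral_liminf) measurable
  also have "\<dots> \<le> ennreal (?B + e)"
    using Liminf_mono[OF always_eventually, of "\<lambda>j. \<integral>\<^sup>+x. ennreal (K j x) \<partial>M" "\<lambda>_. ennreal (?B + e)" sequentially] E
    by (simp add: Liminf_const)
  also have "\<dots> = ennreal ?B + ennreal e" using e by (simp add: ennreal_plus)
  finally show "(\<integral>\<^sup>+x. ennreal (W x ^ (2 * n)) \<partial>M) \<le> ennreal ?B + ennreal e" .
qed

text \<open>Since \<open>exp u \<le> 2 * cosh u\<close>, only even moments occur, and the series of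
  \<open>cosh\<close> has nonnegative terms, so it may be integrated termwise. The resulting terms
  are bounded by absolute Taylor terms of \<open>exp P\<close>, which the majorant with coefficients
  \<open>\<bar>p\<bar>\<close> sums up.\<close>

lemma exp_moment_le_of_exp_poly_char:
  assumes [measurable]: "W \<in> borel_measurable M" and \<epsilon>: "\<epsilon> > 0"
    and P: "\<And>t. \<bar>t\<bar> < \<epsilon> \<Longrightarrow> expectation (\<lambda>x. cos (t * W x)) = exp (poly P t)"
  shows "(\<integral>\<^sup>+x. ennreal (exp (y * W x)) \<partial>M) \<le> ennreal (2 * exp (poly (map_poly abs P) \<bar>y\<bar>))"
proof -
  define c where "c n = \<bar>poly (exp_poly_deriv P n) 0 * exp (poly P 0)\<bar> / fact n * \<bar>y\<bar> ^ n" for n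
  have "(\<integral>\<^sup>+x. ennreal (exp (y * W x)) \<partial>M) \<le> (\<integral>\<^sup>+x. ennreal 2 * ennreal (cosh (y * W x)) \<partial>M)"
  proof (rule nn_integral_mono)
    fix x
    have "ennreal (exp (y * W x)) \<le> ennreal (2 * cosh (y * W x))"
      by (intro ennreal_leI) (simp add: cosh_def field_simps)
    then show "ennreal (exp (y * W x)) \<le> ennreal 2 * ennreal (cosh (y * W x))"
      by (subst ennreal_mult[symmetric]) auto
  qed
  also have "\<dots> = ennreal 2 * (\<integral>\<^sup>+x. ennreal (cosh (y * W x)) \<partial>M)"
    by (rule nn_integral_cmult) (unfold cosh_def, measurable)
  also have "(\<integral>\<^sup>+x. ennreal (cosh (y * W x)) \<partial>M)
      = (\<integral>\<^sup>+x. (\<Sum>n. ennreal (if even n then (y * W x) ^ n /\<^sub>R fact n else 0)) \<partial>M)"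
  proof (rule nn_integral_cong)
    fix x
    have "(\<lambda>n. if even n then (y * W x) ^ n /\<^sub>R fact n else 0) sums cosh (y * W x)"
      by (rule cosh_converges)
    then show "ennreal (cosh (y * W x)) = (\<Sum>n. ennreal (if even n then (y * W x) ^ n /\<^sub>R fact n else 0))"
      by (intro suminf_ennreal_eq[symmetric]) (auto simp: zero_le_even_power)
  qed
  also have "\<dots> = (\<Sum>n. \<integral>\<^sup>+x. ennreal (if even n then (y * W x) ^ n /\<^sub>R fact n else 0) \<partial>M)"
    by (rule nn_integral_suminf) measurable
  also have "\<dots> \<le> (\<Sum>n. ennreal (c n))"
  proof (rule suminf_le)
    fix n
    show "(\<integral>\<^sup>+x. ennreal (if even n then (y * W x) ^ n /\<^sub>R fact n else 0) \<partial>M) \<le> ennreal (c n)"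
    proof (cases "even n")
      case True
      then obtain k where k: "n = 2 * k" by (elim evenE)
      have "(\<integral>\<^sup>+x. ennreal (if even n then (y * W x) ^ n /\<^sub>R fact n else 0) \<partial>M)
         = (\<integral>\<^sup>+x. ennreal (\<bar>y\<bar> ^ n / fact n) * ennreal (W x ^ (2 * k)) \<partial>M)"
      proof (rule nn_integral_cong)
        fix x
        have "(if even n then (y * W x) ^ n /\<^sub>R fact n else 0) = \<bar>y\<bar> ^ n / fact n * W x ^ (2 * k)"
          using True unfolding k[symmetric]
          by (simp add: power_mult_distrib divide_inverse mult_ac power_even_abs)
        then show "ennreal (if even n then (y * W x) ^ n /\<^sub>R fact n else 0)
            = ennreal (\<bar>y\<bar> ^ n / fact n) * ennreal (W x ^ (2 * k))"
          by (simp only:) (subst ennreal_mult, auto)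
      qed
      also have "\<dots> = ennreal (\<bar>y\<bar> ^ n / fact n) * (\<integral>\<^sup>+x. ennreal (W x ^ (2 * k)) \<partial>M)"
        by (rule nn_integral_cmult) measurable
      also have "\<dots> \<le> ennreal (\<bar>y\<bar> ^ n / fact n) * ennreal \<bar>poly (exp_poly_deriv P (2 * k)) 0 * exp (poly P 0)\<bar>"
        by (intro mult_left_mono even_moment_le[OF assms]) auto
      also have "\<dots> = ennreal (c n)" by (simp add: c_def k mult_ac flip: ennreal_mult)
      finally show ?thesis .
    qed auto
  qed auto
  also have "\<dots> \<le> ennreal (exp (poly (map_poly abs P) \<bar>y\<bar>))"
  proof (rule suminf_le_const)
    fix N
    have "(\<Sum>n<N. c n) \<le> exp (poly (map_poly abs P) \<bar>y\<bar>)"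
      unfolding c_def by (rule sum_exp_poly_deriv_le) simp
    then show "(\<Sum>n<N. ennreal (c n)) \<le> ennreal (exp (poly (map_poly abs P) \<bar>y\<bar>))"
      by (subst sum_ennreal) (auto simp: c_def intro!: ennreal_leI)
  qed simp
  finally show ?thesis by (simp add: ennreal_mult mult_left_mono)
qed

end

section \<open>Entire functions without zeros and the ridge inequality\<close>

text \<open>The map \<open>a / (2 M - a)\<close> sends the half-plane \<open>Re a < M\<close> into
  the unit disc and fixes \<open>0\<close>. Schwarz's lemma gives modulus at most \<open>1/2\<close>
  at half the radius, hence \<open>2 * norm (g z) \<le> 2 * M + norm (g z)\<close>.\<close>

lemma borel_caratheodory:
  assumes hol: "g holomorphic_on ball 0 R" and R: "R > 0" and g0: "g 0 = 0"
    and M: "M > 0" and Re: "\<And>z. norm z < R \<Longrightarrow> Re (g z) < M"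
    and z: "norm z \<le> R / 2"
  shows "norm (g z) \<le> 2 * M"
proof -
  define w where "w \<zeta> = g (R * \<zeta>) / (2 * M - g (R * \<zeta>))" for \<zeta> :: complex
  have bnd: "norm (complex_of_real R * \<zeta>) < R" if "norm \<zeta> < 1" for \<zeta> :: complex
    using that R by (simp add: norm_mult)
  have nz: "2 * complex_of_real M - g (R * \<zeta>) \<noteq> 0" if "norm \<zeta> < 1" for \<zeta> :: complex
  proof
    assume "2 * complex_of_real M - g (R * \<zeta>) = 0"
    then have "Re (g (R * \<zeta>)) = 2 * M" by (simp add: complex_eq_iff)
    then show False using Re[OF bnd[OF that]] M by simp
  qed
  have w1: "norm (w \<zeta>) < 1" if "norm \<zeta> < 1" for \<zeta> :: complex
  proof -
    let ?a = "g (R * \<zeta>)"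
    have "(norm ?a)^2 < (norm (2 * complex_of_real M - ?a))^2"
    proof -
      have "(norm (2 * complex_of_real M - ?a))^2 - (norm ?a)^2 = 4 * M * (M - Re ?a)"
        by (simp only: cmod_power2) (simp add: power2_eq_square algebra_simps)
      also have "\<dots> > 0" using M Re[OF bnd[OF that]] by simp
      finally show ?thesis by simp
    qed
    then have "norm ?a < norm (2 * complex_of_real M - ?a)"
      by (simp add: power2_less_imp_less)
    then show ?thesis using nz[OF that] by (simp add: w_def norm_divide)
  qed
  have holw: "w holomorphic_on ball 0 1"
  proof -
    have "(\<lambda>\<zeta>. g (R * \<zeta>)) holomorphic_on ball 0 1"
      using bnd by (intro holomorphic_on_compose_gen[OF _ hol, unfolded o_def] holomorphic_intros) auto
    then show ?thesis unfolding w_def using nz by (intro holomorphic_intros) auto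
  qed
  define \<zeta> where "\<zeta> = z / R"
  have \<zeta>: "norm \<zeta> \<le> 1 / 2" using z R by (simp add: \<zeta>_def norm_divide field_simps)
  have "norm (w \<zeta>) \<le> norm \<zeta>"
    using \<zeta> by (intro Schwarz_Lemma(1)[OF holw _ w1]) (auto simp: w_def g0)
  then have "norm (w \<zeta>) \<le> 1 / 2" using \<zeta> by simp
  moreover have "R * \<zeta> = z" using R by (simp add: \<zeta>_def)
  ultimately have "2 * norm (g z) \<le> norm (2 * complex_of_real M - g z)"
    using nz[of \<zeta>] \<zeta> by (simp add: w_def norm_divide field_simps)
  also have "\<dots> \<le> 2 * M + norm (g z)" using norm_triangle_ineq4[of "2 * complex_of_real M" "g z"] M by simp
  finally show ?thesis by simp
qed

text \<open>The zero-free case of Hadamard's factorization. A global logarithm exists; growth of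
  \<open>f\<close> bounds its real part from above, Borel-Caratheodory turns this into a bound on
  its modulus, and Liouville's theorem makes it a polynomial.\<close>

lemma zero_free_entire_is_exp_polynomial:
  assumes hol: "f holomorphic_on UNIV" and nz: "\<And>z. f z \<noteq> 0"
    and growth: "\<And>z. norm (f z) \<le> exp (B * (1 + norm z) ^ m)"
  shows "\<exists>P. \<forall>z. f z = exp (poly P z)"
proof -
  obtain g where g: "g holomorphic_on UNIV" "\<And>z. exp (g z) = f z"
    using holomorphic_logarithm_exists[of UNIV f 0] hol nz by auto
  define h where "h z = g z - g 0" for z
  have holh: "h holomorphic_on UNIV" unfolding h_def by (intro holomorphic_intros g)
  have Reg: "Re (g z) \<le> B * (1 + norm z) ^ m" for z
    using growth[of z] by (simp flip: g(2))
  \<comment> \<open>The summand \<open>1\<close> makes the bound positive and the inequality strict,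
    as Borel-Caratheodory requires.\<close>
  define K where "K = \<bar>B\<bar> + \<bar>Re (g 0)\<bar> + 1"
  have K: "K > 0" by (simp add: K_def add_nonneg_pos)
  have Reh: "Re (h z) < K * (1 + norm z) ^ m" for z
  proof -
    have one: "1 \<le> (1 + norm z) ^ m" by simp
    have "Re (h z) \<le> B * (1 + norm z) ^ m + \<bar>Re (g 0)\<bar> * 1"
      using Reg[of z] by (simp add: h_def abs_if)
    also have "\<dots> \<le> \<bar>B\<bar> * (1 + norm z) ^ m + \<bar>Re (g 0)\<bar> * (1 + norm z) ^ m"
      using one by (intro add_mono mult_left_mono mult_right_mono) auto
    also have "\<dots> < K * (1 + norm z) ^ m"
      using one unfolding K_def distrib_right by linarith
    finally show ?thesis .
  qed
  have bound: "norm (h z) \<le> (2 * K * 4 ^ m) * norm z ^ m" if z: "1 \<le> norm z" for z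
  proof -
    \<comment> \<open>The bound on \<open>Re h\<close> over the disc of radius
      \<open>2 * norm z\<close>, in which \<open>z\<close> lies at half the radius.\<close>
    define M where "M = K * (1 + 2 * norm z) ^ m"
    have "norm (h z) \<le> 2 * M"
    proof (rule borel_caratheodory[where g = h and z = z and R = "2 * norm z"])
      show "h holomorphic_on ball 0 (2 * norm z)" using holh holomorphic_on_subset by blast
      show "Re (h w) < M" if "norm w < 2 * norm z" for w
      proof -
        have "K * (1 + norm w) ^ m \<le> M"
          unfolding M_def using that K by (intro mult_left_mono power_mono) auto
        then show ?thesis using Reh[of w] by linarith
      qed
    qed (use z K in \<open>auto simp: h_def M_def intro!: mult_pos_pos zero_less_power add_pos_nonneg\<close>)
    also have "2 * M \<le> 2 * (K * (4 * norm z) ^ m)"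
      unfolding M_def using z K by (intro mult_left_mono power_mono) auto
    finally show ?thesis by (simp add: power_mult_distrib mult_ac)
  qed
  define P where "P = (\<Sum>k\<le>m. monom ((deriv ^^ k) h 0 / fact k) k) + [:g 0:]"
  have "g z = poly P z" for z
  proof -
    have "poly P z = (\<Sum>k\<le>m. (deriv ^^ k) h 0 / fact k * z ^ k) + g 0"
      by (simp add: P_def poly_sum poly_monom)
    moreover have "h z = (\<Sum>k\<le>m. (deriv ^^ k) h 0 / fact k * z ^ k)"
      by (rule Liouville_polynomial[OF holh bound])
    ultimately have "poly P z = h z + g 0" by metis
    then show ?thesis by (simp add: h_def)
  qed
  then show ?thesis using g(2) by metis
qed

section \<open>Polynomials along rays and the ridge inequality\<close>

lemma poly_ray_limit:
  fixes P :: "complex poly"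
  assumes "c \<noteq> 0" "m = degree P"
  shows "((\<lambda>r. poly P (of_real r * c) / of_real r ^ m) \<longlongrightarrow> lead_coeff P * c ^ m) at_top"
proof -
  have "((\<lambda>r::real. \<Sum>i\<le>m. coeff P i * c ^ i * (of_real r ^ i / of_real r ^ m)) \<longlongrightarrow>
      (\<Sum>i\<le>m. coeff P i * c ^ i * (if i = m then 1 else 0))) at_top"
  proof (intro tendsto_sum tendsto_mult tendsto_const)
    fix i assume i: "i \<in> {..m}"
    show "((\<lambda>r::real. complex_of_real r ^ i / of_real r ^ m) \<longlongrightarrow> (if i = m then 1 else 0)) at_top"
    proof (cases "i = m")
      case True
      have "\<forall>\<^sub>F r::real in at_top. complex_of_real r ^ i / of_real r ^ m = 1"
        using eventually_gt_at_top[of 0] by eventually_elim (simp add: True)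
      then show ?thesis using True by (simp add: tendsto_eventually)
    next
      case False
      then have "i < m" using i by auto
      have "((\<lambda>r::real. inverse (r ^ (m - i))) \<longlongrightarrow> 0) at_top"
        using \<open>i < m\<close> by (intro tendsto_inverse_0_at_top filterlim_pow_at_top filterlim_ident) auto
      then have "((\<lambda>r::real. complex_of_real (inverse (r ^ (m - i)))) \<longlongrightarrow> complex_of_real 0) at_top"
        by (rule tendsto_of_real)
      moreover have "\<forall>\<^sub>F r::real in at_top. complex_of_real (inverse (r ^ (m - i))) = of_real r ^ i / of_real r ^ m"
        using eventually_gt_at_top[of 0]
        by eventually_elim (use \<open>i < m\<close> in \<open>simp add: power_diff field_simps\<close>)
      ultimately show ?thesis using False by (simp add: tendsto_cong)
    qed
  qed
  moreover have "(\<Sum>i\<le>m. coeff P i * c ^ i * (if i = m then 1 else 0)) = lead_coeff P * c ^ m"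
    by (simp add: if_distrib cong: if_cong) (simp add: assms)
  moreover have "(\<Sum>i\<le>m. coeff P i * c ^ i * (of_real r ^ i / of_real r ^ m)) = poly P (of_real r * c) / of_real r ^ m" for r :: real
    by (simp add: poly_altdef assms sum_divide_distrib power_mult_distrib mult_ac)
  ultimately show ?thesis by simp
qed

text \<open>The ridge inequality \<open>Re P(x + iy) \<le> Re P(x)\<close>, compared to leading order along the rays
  with arguments \<open>2 pi/m\<close>, \<open>pi/m\<close> and \<open>\<plusminus>pi/(2m)\<close>, kills the leading coefficient.\<close>

lemma marcinkiewicz_polynomial:
  fixes P :: "complex poly"
  assumes ridge: "\<And>z. Re (poly P z) \<le> Re (poly P (of_real (Re z)))"
  shows "degree P \<le> 2"
proof (rule ccontr)
  define m where "m = degree P"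
  define a where "a = lead_coeff P"
  assume "\<not> degree P \<le> 2"
  then have m: "m \<ge> 3" by (simp add: m_def)
  \<comment> \<open>Divide the ridge inequality by \<open>r ^ m\<close> on the ray of argument
    \<open>t\<close> and let \<open>r\<close> tend to infinity. If \<open>cos t = 0\<close> the ray
    projects to the origin, so the comparison value is the constant \<open>Re (poly P 0)\<close> and
    has limit \<open>0\<close>.\<close>
  have ineq: "Re (a * cis (real m * t)) \<le> Re a * cos t ^ m" for t
  proof (cases "cos t = 0")
    case True
    have "((\<lambda>r. Re (poly P (of_real r * cis t) / of_real r ^ m)) \<longlongrightarrow> Re (a * cis t ^ m)) at_top"
      unfolding a_def by (intro tendsto_Re poly_ray_limit) (auto simp: m_def)
    moreover have "((\<lambda>r. Re (poly P 0) / r ^ m) \<longlongrightarrow> 0) at_top"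
      using m by (intro real_tendsto_divide_at_top tendsto_const filterlim_pow_at_top filterlim_ident) auto
    moreover have "\<forall>\<^sub>F r in at_top. Re (poly P (of_real r * cis t) / of_real r ^ m) \<le> Re (poly P 0) / r ^ m"
      using eventually_gt_at_top[of 0]
    proof eventually_elim
      case (elim r)
      have "Re (poly P (of_real r * cis t)) \<le> Re (poly P 0)"
        using ridge[of "of_real r * cis t"] True by simp
      then show ?case using elim by (simp add: divide_right_mono flip: of_real_power)
    qed
    ultimately have "Re (a * cis t ^ m) \<le> 0"
      by (intro tendsto_le[OF trivial_limit_at_top_linorder])
    then show ?thesis unfolding Complex.DeMoivre using m True by (simp add: zero_power)
  next
    case False
    have "((\<lambda>r. Re (poly P (of_real r * cis t) / of_real r ^ m)) \<longlongrightarrow> Re (a * cis t ^ m)) at_top"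
      unfolding a_def by (intro tendsto_Re poly_ray_limit) (auto simp: m_def)
    moreover have "((\<lambda>r. Re (poly P (of_real r * of_real (cos t)) / of_real r ^ m)) \<longlongrightarrow> Re (a * of_real (cos t) ^ m)) at_top"
      unfolding a_def by (intro tendsto_Re poly_ray_limit) (use False in \<open>auto simp: m_def\<close>)
    moreover have "\<forall>\<^sub>F r in at_top. Re (poly P (of_real r * cis t) / of_real r ^ m)
        \<le> Re (poly P (of_real r * of_real (cos t)) / of_real r ^ m)"
      using eventually_gt_at_top[of 0]
    proof eventually_elim
      case (elim r)
      have "Re (poly P (of_real r * cis t)) \<le> Re (poly P (of_real r * of_real (cos t)))"
        using ridge[of "of_real r * cis t"] by simp
      then show ?case using elim by (simp add: divide_right_mono flip: of_real_power)
    qed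
    ultimately have "Re (a * cis t ^ m) \<le> Re (a * of_real (cos t) ^ m)"
      by (intro tendsto_le[OF trivial_limit_at_top_linorder])
    then show ?thesis unfolding Complex.DeMoivre by (simp flip: of_real_power)
  qed
  \<comment> \<open>Here degree at least \<open>3\<close> matters: it puts \<open>2 * pi / m\<close>
    strictly between \<open>0\<close> and \<open>pi\<close>.\<close>
  have coslt: "\<bar>cos s ^ m\<bar> < 1" if "0 < s" "s < pi" for s
  proof -
    have "sin s > 0" using that by (rule sin_gt_zero)
    then have "\<bar>cos s\<bar> < 1" using sin_cos_squared_add[of s]
      by (metis abs_square_less_1 add_less_cancel_right add.commute add.right_neutral less_add_same_cancel1 zero_less_power)
    then show ?thesis using m by (simp add: power_abs power_less_one_iff)
  qed
  \<comment> \<open>The left side of \<open>ineq\<close> is \<open>Re a\<close> at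
    \<open>2 * pi / m\<close> and \<open>- Re a\<close> at \<open>pi / m\<close>, which forces
    \<open>Re a = 0\<close>. At \<open>pi / (2 * m)\<close> and its negative it is
    \<open>- Im a\<close> and \<open>Im a\<close>, against a right side that is now
    \<open>0\<close>.\<close>
  have "Re a * (1 - cos (2 * pi / m) ^ m) \<le> 0"
    using ineq[of "2 * pi / m"] m by (simp add: algebra_simps)
  moreover have "1 - cos (2 * pi / m) ^ m > 0"
    using abs_less_iff[THEN iffD1, OF coslt[of "2 * pi / m"]] m by (simp add: field_simps)
  ultimately have Re_le: "Re a \<le> 0" by (simp add: mult_le_0_iff)
  have "Re a * (1 + cos (pi / m) ^ m) \<ge> 0"
    using ineq[of "pi / m"] m by (simp add: algebra_simps)
  moreover have "1 + cos (pi / m) ^ m > 0"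
    using abs_less_iff[THEN iffD1, OF coslt[of "pi / m"]] m by (simp add: field_simps)
  ultimately have Re_ge: "Re a \<ge> 0" by (simp add: zero_le_mult_iff)
  from Re_le Re_ge have Re0: "Re a = 0" by simp
  have "Im a \<ge> 0" using ineq[of "pi / (2 * m)"] m Re0 by simp
  moreover have "Im a \<le> 0" using ineq[of "- (pi / (2 * m))"] m Re0 by simp
  ultimately have "a = 0" using Re0 by (simp add: complex_eq_iff)
  then show False using m by (simp add: a_def m_def)
qed

section \<open>Random variables with exponential moments of finite order\<close>

text \<open>The integral is extended-valued, so the bound includes finiteness of all exponential
  moments. It is the real-axis form of finite order for the Laplace transform.\<close>

definition exp_type :: "'a measure \<Rightarrow> ('a \<Rightarrow> real) \<Rightarrow> bool" where
  "exp_type M U \<longleftrightarrow> U \<in> borel_measurable M \<and>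
     (\<exists>B m. \<forall>y. (\<integral>\<^sup>+x. ennreal (exp (y * U x)) \<partial>M) \<le> ennreal (exp (B * (1 + \<bar>y\<bar>) ^ m)))"

lemma poly_le_const_power:
  fixes P :: "real poly"
  shows "poly P \<bar>y\<bar> \<le> (\<Sum>i\<le>degree P. \<bar>coeff P i\<bar>) * (1 + \<bar>y\<bar>) ^ degree P"
proof -
  have "poly P \<bar>y\<bar> \<le> (\<Sum>i\<le>degree P. \<bar>coeff P i\<bar> * (1 + \<bar>y\<bar>) ^ degree P)"
    unfolding poly_altdef
  proof (rule sum_mono)
    fix i assume i: "i \<in> {..degree P}"
    have "\<bar>y\<bar> ^ i \<le> (1 + \<bar>y\<bar>) ^ i" by (intro power_mono) auto
    also have "\<dots> \<le> (1 + \<bar>y\<bar>) ^ degree P" using i by (intro power_increasing) auto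
    finally have "\<bar>coeff P i\<bar> * \<bar>y\<bar> ^ i \<le> \<bar>coeff P i\<bar> * (1 + \<bar>y\<bar>) ^ degree P"
      by (rule mult_left_mono) simp
    moreover have "coeff P i * \<bar>y\<bar> ^ i \<le> \<bar>coeff P i\<bar> * \<bar>y\<bar> ^ i" by (intro mult_right_mono) auto
    ultimately show "coeff P i * \<bar>y\<bar> ^ i \<le> \<bar>coeff P i\<bar> * (1 + \<bar>y\<bar>) ^ degree P" by linarith
  qed
  then show ?thesis by (simp add: sum_distrib_right)
qed

context prob_space
begin

lemma indep_set_swap: "indep_set A B \<Longrightarrow> indep_set B A"
  unfolding indep_sets2_eq by (metis Int_commute mult.commute)

lemma indep_var_swap: "indep_var S X T Y \<Longrightarrow> indep_var T Y S X"
  unfolding indep_var_eq by (blast intro: indep_set_swap)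

lemma nn_integral_indep_mult:
  fixes f g :: "real \<Rightarrow> ennreal"
  assumes ind: "indep_var borel U borel R"
    and [measurable]: "f \<in> borel_measurable borel" "g \<in> borel_measurable borel"
  shows "(\<integral>\<^sup>+x. f (U x) * g (R x) \<partial>M) = (\<integral>\<^sup>+x. f (U x) \<partial>M) * (\<integral>\<^sup>+x. g (R x) \<partial>M)"
proof -
  have rv[measurable]: "U \<in> borel_measurable M" "R \<in> borel_measurable M"
    using ind by (auto dest: indep_var_rv1 indep_var_rv2)
  interpret R: prob_space "distr M borel R" by (rule prob_space_distr) measurable
  have "(\<integral>\<^sup>+x. f (U x) * g (R x) \<partial>M)
      = (\<integral>\<^sup>+p. f (fst p) * g (snd p) \<partial>(distr M borel U \<Otimes>\<^sub>M distr M borel R))"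
    using ind unfolding indep_var_distribution_eq by (simp add: nn_integral_distr)
  also have "\<dots> = (\<integral>\<^sup>+u. \<integral>\<^sup>+r. f u * g r \<partial>distr M borel R \<partial>distr M borel U)"
    by (subst R.nn_integral_fst[symmetric]) auto
  also have "\<dots> = (\<integral>\<^sup>+u. f u \<partial>distr M borel U) * (\<integral>\<^sup>+r. g r \<partial>distr M borel R)"
    by (simp add: nn_integral_cmult nn_integral_multc)
  finally show ?thesis by (simp add: nn_integral_distr)
qed

text \<open>Some interval \<open>[-n, n]\<close> carries more than half of the mass, and there
  \<open>exp (y * R)\<close> is at least \<open>exp (- n * \<bar>y\<bar>)\<close>. This bounds the
  moment from below for an arbitrary \<open>R\<close>.\<close>

lemma exp_moment_ge:
  assumes [measurable]: "R \<in> borel_measurable M"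
  shows "\<exists>c\<ge>0. \<forall>y. ennreal (exp (- (c * \<bar>y\<bar>)) / 2) \<le> (\<integral>\<^sup>+x. ennreal (exp (y * R x)) \<partial>M)"
proof -
  define A where "A n = {x \<in> space M. \<bar>R x\<bar> \<le> real n}" for n :: nat
  have [measurable]: "A n \<in> sets M" for n unfolding A_def by measurable
  have "(\<lambda>n. prob (A n)) \<longlonglongrightarrow> prob (\<Union>n. A n)"
    by (rule finite_Lim_measure_incseq) (auto simp: A_def incseq_def)
  moreover have "(\<Union>n. A n) = space M" by (auto simp: A_def real_arch_simple)
  ultimately have "(\<lambda>n. prob (A n)) \<longlonglongrightarrow> 1" by (simp add: prob_space)
  then have "\<forall>\<^sub>F n in sequentially. prob (A n) > 1 / 2" by (rule order_tendstoD) simp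
  then obtain n where n: "prob (A n) > 1 / 2" by (auto simp: eventually_sequentially)
  have "ennreal (exp (- (real n * \<bar>y\<bar>)) / 2) \<le> (\<integral>\<^sup>+x. ennreal (exp (y * R x)) \<partial>M)" for y
  proof -
    have "ennreal (exp (- (real n * \<bar>y\<bar>)) / 2) \<le> ennreal (exp (- (real n * \<bar>y\<bar>)) * prob (A n))"
      using n by (intro ennreal_leI) (simp add: field_simps)
    also have "\<dots> = (\<integral>\<^sup>+x. ennreal (exp (- (real n * \<bar>y\<bar>))) * indicator (A n) x \<partial>M)"
      by (subst nn_integral_cmult_indicator) (auto simp: emeasure_eq_measure ennreal_mult)
    also have "\<dots> \<le> (\<integral>\<^sup>+x. ennreal (exp (y * R x)) \<partial>M)"
    proof (rule nn_integral_mono)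
      fix x
      show "ennreal (exp (- (real n * \<bar>y\<bar>))) * indicator (A n) x \<le> ennreal (exp (y * R x))"
      proof (cases "x \<in> A n")
        case True
        have "\<bar>y * R x\<bar> \<le> real n * \<bar>y\<bar>"
          using True by (auto simp: A_def abs_mult mult.commute intro!: mult_left_mono)
        then show ?thesis using True by (auto intro!: ennreal_leI)
      qed simp
    qed
    finally show ?thesis .
  qed
  then show ?thesis by (intro exI[of _ "real n"]) auto
qed

text \<open>The exponential moment of the sum is the product of those of \<open>U\<close> and
  \<open>R\<close>; dividing by the lower bound for the factor of \<open>R\<close> leaves a bound
  for \<open>U\<close>.\<close>

lemma exp_type_indep_summand:
  assumes ind: "indep_var borel U borel R" and L: "exp_type M (\<lambda>x. U x + R x)"
  shows "exp_type M U"
proof -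
  have [measurable]: "U \<in> borel_measurable M" "R \<in> borel_measurable M"
    using ind by (auto dest: indep_var_rv1 indep_var_rv2)
  obtain B m where B: "\<And>y. (\<integral>\<^sup>+x. ennreal (exp (y * (U x + R x))) \<partial>M) \<le> ennreal (exp (B * (1 + \<bar>y\<bar>) ^ m))"
    using L unfolding exp_type_def by blast
  obtain c where c: "c \<ge> 0" "\<And>y. ennreal (exp (- (c * \<bar>y\<bar>)) / 2) \<le> (\<integral>\<^sup>+x. ennreal (exp (y * R x)) \<partial>M)"
    using exp_moment_ge[of R] by auto
  have "(\<integral>\<^sup>+x. ennreal (exp (y * U x)) \<partial>M) \<le> ennreal (exp ((\<bar>B\<bar> + c + 1) * (1 + \<bar>y\<bar>) ^ Suc m))" for y
  proof -
    define q where "q = 1 + \<bar>y\<bar>"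
    have q: "q \<ge> 1" by (simp add: q_def)
    have "(\<integral>\<^sup>+x. ennreal (exp (y * U x)) \<partial>M) * ennreal (exp (- (c * \<bar>y\<bar>)) / 2)
       \<le> (\<integral>\<^sup>+x. ennreal (exp (y * U x)) \<partial>M) * (\<integral>\<^sup>+x. ennreal (exp (y * R x)) \<partial>M)"
      by (intro mult_left_mono c) auto
    also have "\<dots> = (\<integral>\<^sup>+x. ennreal (exp (y * (U x + R x))) \<partial>M)"
      by (subst nn_integral_indep_mult[OF ind, symmetric])
        (auto simp: distrib_left exp_add ennreal_mult)
    also have "\<dots> \<le> ennreal (exp (B * q ^ m))" using B by (simp add: q_def)
    finally have "(\<integral>\<^sup>+x. ennreal (exp (y * U x)) \<partial>M) * ennreal (exp (- (c * \<bar>y\<bar>)) / 2) * ennreal (2 * exp (c * \<bar>y\<bar>))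
        \<le> ennreal (exp (B * q ^ m)) * ennreal (2 * exp (c * \<bar>y\<bar>))"
      by (intro mult_right_mono) auto
    moreover have "ennreal (exp (- (c * \<bar>y\<bar>)) / 2) * ennreal (2 * exp (c * \<bar>y\<bar>)) = 1"
      by (simp add: exp_minus field_simps flip: ennreal_mult)
    ultimately have "(\<integral>\<^sup>+x. ennreal (exp (y * U x)) \<partial>M) \<le> ennreal (exp (B * q ^ m)) * ennreal (2 * exp (c * \<bar>y\<bar>))"
      by (simp add: mult.assoc)
    also have "\<dots> = ennreal (exp (B * q ^ m) * (2 * exp (c * \<bar>y\<bar>)))" by (simp add: ennreal_mult)
    \<comment> \<open>The factor \<open>2\<close> is at most \<open>exp 1\<close>, which is the
      \<open>1\<close> in the constant. The power \<open>Suc m\<close> absorbs the linear loss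
      \<open>c * \<bar>y\<bar>\<close> even when \<open>m = 0\<close>.\<close>
    also have "\<dots> \<le> ennreal (exp ((\<bar>B\<bar> + c + 1) * q ^ Suc m))"
    proof (rule ennreal_leI)
      have "exp (B * q ^ m) * (2 * exp (c * \<bar>y\<bar>)) \<le> exp (B * q ^ m) * (exp 1 * exp (c * \<bar>y\<bar>))"
        using exp_ge_add_one_self[of 1] by (intro mult_left_mono mult_right_mono) auto
      also have "\<dots> = exp (B * q ^ m + 1 + c * \<bar>y\<bar>)" by (simp add: exp_add)
      also have "B * q ^ m + 1 + c * \<bar>y\<bar> \<le> \<bar>B\<bar> * q ^ Suc m + 1 * q ^ Suc m + c * q ^ Suc m"
      proof (intro add_mono)
        have "B * q ^ m \<le> \<bar>B\<bar> * q ^ m" using q by (intro mult_right_mono) auto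
        also have "\<dots> \<le> \<bar>B\<bar> * q ^ Suc m" using q by (intro mult_left_mono power_increasing) auto
        finally show "B * q ^ m \<le> \<bar>B\<bar> * q ^ Suc m" .
        show "1 \<le> 1 * q ^ Suc m" using one_le_power[OF q, of "Suc m"] by simp
        have "\<bar>y\<bar> \<le> q ^ 1" by (simp add: q_def)
        also have "\<dots> \<le> q ^ Suc m" using q by (intro power_increasing) auto
        finally show "c * \<bar>y\<bar> \<le> c * q ^ Suc m" using c(1) by (rule mult_left_mono)
      qed
      finally show "exp (B * q ^ m) * (2 * exp (c * \<bar>y\<bar>)) \<le> exp ((\<bar>B\<bar> + c + 1) * q ^ Suc m)"
        by (simp only: distrib_right exp_le_cancel_iff) (simp add: algebra_simps)
    qed
    finally show ?thesis by (simp add: q_def)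
  qed
  then show ?thesis unfolding exp_type_def using \<open>U \<in> borel_measurable M\<close> by blast
qed

lemma exp_type_integrable:
  assumes "exp_type M U"
  shows "integrable M (\<lambda>x. exp (y * U x))"
    and "integrable M (\<lambda>x. exp (z * complex_of_real (U x)))"
proof -
  have [measurable]: "U \<in> borel_measurable M" using assms by (simp add: exp_type_def)
  show *: "integrable M (\<lambda>x. exp (y * U x))" for y
  proof (rule integrableI_bounded)
    obtain B m where "(\<integral>\<^sup>+x. ennreal (exp (y * U x)) \<partial>M) \<le> ennreal (exp (B * (1 + \<bar>y\<bar>) ^ m))"
      using assms unfolding exp_type_def by blast
    then show "(\<integral>\<^sup>+x. ennreal (norm (exp (y * U x))) \<partial>M) < \<infinity>" by (simp add: le_less_trans)
  qed measurable
  show "integrable M (\<lambda>x. exp (z * complex_of_real (U x)))"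
    by (rule Bochner_Integration.integrable_bound[OF *[of "Re z"]]) auto
qed

lemma exp_type_growth:
  assumes "exp_type M U"
  shows "\<exists>B m. \<forall>z. norm (expectation (\<lambda>x. exp (z * complex_of_real (U x)))) \<le> exp (B * (1 + norm z) ^ m)"
proof -
  have [measurable]: "U \<in> borel_measurable M" using assms by (simp add: exp_type_def)
  obtain B m where B: "\<And>y. (\<integral>\<^sup>+x. ennreal (exp (y * U x)) \<partial>M) \<le> ennreal (exp (B * (1 + \<bar>y\<bar>) ^ m))"
    using assms unfolding exp_type_def by blast
  have "norm (expectation (\<lambda>x. exp (z * complex_of_real (U x)))) \<le> exp (\<bar>B\<bar> * (1 + norm z) ^ m)" for z
  proof -
    have "norm (expectation (\<lambda>x. exp (z * complex_of_real (U x)))) \<le> expectation (\<lambda>x. exp (Re z * U x))"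
      using integral_norm_bound[of M "\<lambda>x. exp (z * complex_of_real (U x))"] by simp
    also have "\<dots> \<le> exp (B * (1 + \<bar>Re z\<bar>) ^ m)"
    proof -
      have "ennreal (expectation (\<lambda>x. exp (Re z * U x))) \<le> ennreal (exp (B * (1 + \<bar>Re z\<bar>) ^ m))"
        using B[of "Re z"] exp_type_integrable(1)[OF assms] by (subst nn_integral_eq_integral[symmetric]) auto
      then show ?thesis by simp
    qed
    also have "B * (1 + \<bar>Re z\<bar>) ^ m \<le> \<bar>B\<bar> * (1 + norm z) ^ m"
      using abs_Re_le_cmod[of z] by (intro mult_mono power_mono) auto
    finally show ?thesis by simp
  qed
  then show ?thesis by blast
qed

text \<open>The transform is the power series whose coefficients are moments over factorials.
  Summation and expectation may be exchanged because the partial sums of absolute values are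
  dominated by an integrable function.\<close>

lemma exp_type_holomorphic:
  assumes U: "exp_type M U"
  shows "(\<lambda>z. expectation (\<lambda>x. exp (z * complex_of_real (U x)))) holomorphic_on UNIV"
proof -
  have [measurable]: "U \<in> borel_measurable M" using assms by (simp add: exp_type_def)
  define c where "c n = expectation (\<lambda>x. complex_of_real (U x) ^ n /\<^sub>R fact n)" for n
  have sums: "(\<lambda>n. c n * z ^ n) sums expectation (\<lambda>x. exp (z * complex_of_real (U x)))" for z
  proof -
    define f where "f n x = (z * complex_of_real (U x)) ^ n /\<^sub>R fact n" for n x
    \<comment> \<open>Dominates \<open>exp (norm z * \<bar>U x\<bar>)\<close> for either sign of
      \<open>U x\<close>, using exponential moments only.\<close>
    define g where "g x = exp (norm z * U x) + exp (- norm z * U x)" for x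
    have [measurable]: "f n \<in> borel_measurable M" for n unfolding f_def by measurable
    have ig: "integrable M g" unfolding g_def
      by (intro Bochner_Integration.integrable_add exp_type_integrable(1)[OF U])
    have part: "(\<Sum>n<N. norm (f n x)) \<le> g x" for x N
    proof -
      have s: "(\<lambda>n. norm (f n x)) sums exp (norm (z * complex_of_real (U x)))"
        using exp_converges[of "norm (z * complex_of_real (U x))"]
        by (simp add: f_def norm_power norm_divide divide_inverse)
      have "(\<Sum>n<N. norm (f n x)) \<le> exp (norm (z * complex_of_real (U x)))"
        using sum_le_suminf[OF sums_summable[OF s], of "{..<N}"] sums_unique[OF s] by simp
      also have "\<dots> \<le> g x" by (cases "U x \<ge> 0") (auto simp: g_def norm_mult abs_if)
      finally show ?thesis .
    qed
    have le: "norm (f n x) \<le> g x" for n x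
      using part[of x "Suc n"] sum_nonneg[of "{..<n}" "\<lambda>n. norm (f n x)"] by simp
    have int: "integrable M (f n)" for n
      by (rule Bochner_Integration.integrable_bound[OF ig]) (use le in \<open>auto simp: g_def\<close>)
    have fsum: "(\<lambda>n. f n x) sums exp (z * complex_of_real (U x))" for x
      unfolding f_def by (rule exp_converges)
    have "(\<lambda>n. expectation (f n)) sums expectation (\<lambda>x. \<Sum>n. f n x)"
    proof (rule sums_integral[OF int])
      show "AE x in M. summable (\<lambda>n. norm (f n x))"
        by (rule AE_I2) (rule summableI_nonneg_bounded[OF _ part], simp)
      show "summable (\<lambda>n. expectation (\<lambda>x. norm (f n x)))"
      proof (rule summableI_nonneg_bounded)
        fix N
        have "(\<Sum>n<N. expectation (\<lambda>x. norm (f n x))) = expectation (\<lambda>x. \<Sum>n<N. norm (f n x))"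
          using int by (subst Bochner_Integration.integral_sum) auto
        also have "\<dots> \<le> expectation g"
          using int ig part by (intro integral_mono) auto
        finally show "(\<Sum>n<N. expectation (\<lambda>x. norm (f n x))) \<le> expectation g" .
      qed auto
    qed
    moreover have "expectation (f n) = c n * z ^ n" for n
    proof -
      have "expectation (f n) = expectation (\<lambda>x. (complex_of_real (U x) ^ n /\<^sub>R fact n) * z ^ n)"
        by (intro Bochner_Integration.integral_cong) (auto simp: f_def power_mult_distrib)
      then show ?thesis by (simp add: c_def)
    qed
    moreover have "(\<Sum>n. f n x) = exp (z * complex_of_real (U x))" for x
      using fsum by (rule sums_unique[symmetric])
    ultimately show ?thesis by simp
  qed
  have "(\<lambda>z. expectation (\<lambda>x. exp (z * complex_of_real (U x)))) holomorphic_on ball 0 (norm z + 1)" for z :: complex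
    by (rule power_series_holomorphic[where a = c]) (use sums in simp)
  then have "(\<lambda>z. expectation (\<lambda>x. exp (z * complex_of_real (U x)))) field_differentiable at z" for z
    using holomorphic_on_imp_differentiable_at[of _ "ball 0 (norm z + 1)" z] by (auto simp: dist_norm)
  then show ?thesis by (auto simp: holomorphic_on_def intro: field_differentiable_at_within)
qed

text \<open>The squared modulus is the characteristic function of \<open>L - L'\<close> for an independent copy \<open>L'\<close>;
  this symmetrization turns the hypothesis into one about \<open>E cos (tW)\<close>.\<close>

lemma exp_type_of_exp_poly_char:
  assumes [measurable]: "L \<in> borel_measurable M" and \<epsilon>: "\<epsilon> > 0"
    and P: "\<And>t. \<bar>t\<bar> < \<epsilon> \<Longrightarrow> (norm (char (distr M borel L) t))\<^sup>2 = exp (poly P t)"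
  shows "exp_type M L"
proof -
  define \<mu> where "\<mu> = distr M borel L"
  \<comment> \<open>The space \<open>M\<close> need not carry an independent copy of
    \<open>L\<close>, so it is built on the product of the law of \<open>L\<close> with the law of
    \<open>- L\<close>.\<close>
  define \<nu> where "\<nu> = distr M borel (\<lambda>x. - L x)"
  interpret \<mu>: prob_space \<mu> unfolding \<mu>_def by (rule prob_space_distr) measurable
  interpret \<nu>: prob_space \<nu> unfolding \<nu>_def by (rule prob_space_distr) measurable
  interpret N: pair_prob_space \<mu> \<nu> ..
  define N where "N = \<mu> \<Otimes>\<^sub>M \<nu>"
  have [measurable_cong]: "sets \<mu> = sets borel" "sets \<nu> = sets borel" by (auto simp: \<mu>_def \<nu>_def)
  interpret N: prob_space N unfolding N_def by (rule N.prob_space_axioms)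
  have sN: "sets N = sets (borel \<Otimes>\<^sub>M borel)"
    unfolding N_def by (rule sets_pair_measure_cong) (simp_all add: \<mu>_def \<nu>_def)
  have d: "distr N borel fst = \<mu>" "distr N borel snd = \<nu>"
  proof -
    have "distr N \<mu> fst = \<mu>" unfolding N_def by (rule \<nu>.distr_pair_fst)
    moreover have "distr N borel fst = distr N \<mu> fst" by (rule distr_cong) (auto simp: \<mu>_def)
    ultimately show "distr N borel fst = \<mu>" by simp
    have "distr N borel snd = distr N \<nu> snd" by (rule distr_cong) (auto simp: \<nu>_def)
    moreover have "distr N \<nu> snd = \<nu>"
    proof (rule measure_eqI)
      fix A assume A: "A \<in> sets (distr N \<nu> snd)"
      then have "emeasure (distr N \<nu> snd) A = emeasure N (space \<mu> \<times> A)"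
        using sets.sets_into_space[of A \<nu>]
        by (subst emeasure_distr) (auto simp: N_def space_pair_measure intro!: arg_cong2[where f = emeasure])
      also have "\<dots> = emeasure \<nu> A" using A by (simp add: N_def \<nu>.emeasure_pair_measure_Times \<mu>.emeasure_space_1)
      finally show "emeasure (distr N \<nu> snd) A = emeasure \<nu> A" .
    qed simp
    ultimately show "distr N borel snd = \<nu>" by simp
  qed
  have mf[measurable]: "fst \<in> borel_measurable N" "snd \<in> borel_measurable N" unfolding N_def by measurable
  have ind: "N.indep_var borel fst borel snd"
    unfolding N.indep_var_distribution_eq d
  proof (intro conjI mf)
    have "distr N (borel \<Otimes>\<^sub>M borel) (\<lambda>x. (fst x, snd x)) = distr N N (\<lambda>x. x)"
      by (rule distr_cong) (auto simp: sN)
    then show "\<mu> \<Otimes>\<^sub>M \<nu> = distr N (borel \<Otimes>\<^sub>M borel) (\<lambda>x. (fst x, snd x))"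
      by (simp add: distr_id2 flip: N_def)
  qed
  define W where "W p = fst p + snd p" for p :: "real \<times> real"
  have [measurable]: "W \<in> borel_measurable N" unfolding W_def by measurable
  have "N.expectation (\<lambda>p. cos (t * W p)) = exp (poly P t)" if "\<bar>t\<bar> < \<epsilon>" for t
  proof -
    have "char (distr N borel W) t = char \<mu> t * char \<nu> t"
      unfolding W_def using N.char_distr_add[OF ind] by (simp add: d)
    moreover have "char \<nu> t = cnj (char \<mu> t)"
    proof -
      have "char \<nu> t = expectation (\<lambda>x. cnj (iexp (t * L x)))"
        by (simp add: \<nu>_def char_def integral_distr exp_cnj del: integral_cnj)
      then show ?thesis by (simp add: \<mu>_def char_def integral_distr)
    qed
    ultimately have "char (distr N borel W) t = complex_of_real (exp (poly P t))"
      using P[OF that] by (simp add: complex_norm_square[symmetric] \<mu>_def flip: of_real_power)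
    moreover have "Re (char (distr N borel W) t) = N.expectation (\<lambda>p. cos (t * W p))"
    proof -
      have "integrable N (\<lambda>p. iexp (t * W p))"
        by (rule N.integrable_iexp) auto
      then show ?thesis by (simp add: char_def integral_distr Re_exp flip: integral_Re)
    qed
    ultimately show ?thesis by simp
  qed
  then have "(\<integral>\<^sup>+p. ennreal (exp (y * W p)) \<partial>N) \<le> ennreal (2 * exp (poly (map_poly abs P) \<bar>y\<bar>))" for y
    by (intro N.exp_moment_le_of_exp_poly_char[OF _ \<epsilon>]) auto
  moreover have "\<exists>B m. \<forall>y. 2 * exp (poly (map_poly abs P) \<bar>y\<bar>) \<le> exp (B * (1 + \<bar>y\<bar>) ^ m)"
  proof (intro exI allI)
    fix y :: real
    define Q where "Q = map_poly abs P"
    let ?s = "\<Sum>i\<le>degree Q. \<bar>coeff Q i\<bar>"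
    have "2 * exp (poly Q \<bar>y\<bar>) \<le> exp 1 * exp (poly Q \<bar>y\<bar>)"
      using exp_ge_add_one_self[of 1] by (intro mult_right_mono) auto
    also have "\<dots> = exp (poly Q \<bar>y\<bar> + 1)" by (simp add: exp_add)
    also have "poly Q \<bar>y\<bar> + 1 \<le> ?s * (1 + \<bar>y\<bar>) ^ degree Q + 1 * (1 + \<bar>y\<bar>) ^ degree Q"
      by (intro add_mono poly_le_const_power) simp
    finally show "2 * exp (poly (map_poly abs P) \<bar>y\<bar>) \<le> exp (((\<Sum>i\<le>degree (map_poly abs P). \<bar>coeff (map_poly abs P) i\<bar>) + 1) * (1 + \<bar>y\<bar>) ^ degree (map_poly abs P))"
      by (simp add: Q_def distrib_right)
  qed
  ultimately have "exp_type N W"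
    unfolding exp_type_def by (meson \<open>W \<in> borel_measurable N\<close> ennreal_leI order_trans)
  \<comment> \<open>The symmetrization is undone: \<open>fst\<close> is an independent summand of
    \<open>W\<close> and has the law of \<open>L\<close>.\<close>
  then have "exp_type N fst" using N.exp_type_indep_summand[OF ind] by (simp add: W_def[abs_def])
  moreover have "(\<integral>\<^sup>+p. ennreal (exp (y * fst p)) \<partial>N) = (\<integral>\<^sup>+x. ennreal (exp (y * L x)) \<partial>M)" for y
  proof -
    have "(\<integral>\<^sup>+p. ennreal (exp (y * fst p)) \<partial>N) = (\<integral>\<^sup>+u. ennreal (exp (y * u)) \<partial>distr N borel fst)"
      by (simp add: nn_integral_distr)
    also have "\<dots> = (\<integral>\<^sup>+x. ennreal (exp (y * L x)) \<partial>M)"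
      unfolding d by (simp add: \<mu>_def nn_integral_distr)
    finally show ?thesis .
  qed
  ultimately show ?thesis unfolding exp_type_def by simp
qed

end

section \<open>The Darmois-Skitovich theorem\<close>

lemma poly_map_poly_of_real: "poly (map_poly complex_of_real P) (complex_of_real t) = complex_of_real (poly P t)"
  by (induction P) (simp_all add: map_poly_pCons)

context prob_space
begin

lemma char_distr_eq_expectation:
  assumes [measurable]: "U \<in> borel_measurable M"
  shows "char (distr M borel U) t = expectation (\<lambda>x. exp (\<i> * complex_of_real t * complex_of_real (U x)))"
  by (simp add: char_def integral_distr mult.assoc)

lemma char_distr_scale:
  assumes [measurable]: "U \<in> borel_measurable M"
  shows "char (distr M borel (\<lambda>x. c * U x)) t = char (distr M borel U) (c * t)"
  by (simp add: char_def integral_distr mult_ac)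

text \<open>A decomposition theorem of Cramer type. On the imaginary axis
  \<open>F L z * F L (- z)\<close> is the squared modulus of the characteristic function; as both
  sides are entire, its exponential form near \<open>0\<close> spreads to the whole plane, so
  neither \<open>F L\<close> nor its factor \<open>F U\<close> has a zero.\<close>

lemma summand_mgf_exp_quadratic:
  assumes ind: "indep_var borel U borel R" and \<epsilon>: "\<epsilon> > 0"
    and P: "\<And>t. \<bar>t\<bar> < \<epsilon> \<Longrightarrow> (norm (char (distr M borel (\<lambda>x. U x + R x)) t))\<^sup>2 = exp (poly P t)"
  shows "\<exists>Q. degree Q \<le> 2 \<and> (\<forall>z. expectation (\<lambda>x. exp (z * complex_of_real (U x))) = exp (poly Q z))"
proof -
  have [measurable]: "U \<in> borel_measurable M" "R \<in> borel_measurable M"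
    using ind by (auto dest: indep_var_rv1 indep_var_rv2)
  define L where "L x = U x + R x" for x
  have [measurable]: "L \<in> borel_measurable M" unfolding L_def by measurable
  have L: "exp_type M L"
    using P unfolding L_def by (intro exp_type_of_exp_poly_char[OF _ \<epsilon>]) auto
  have U: "exp_type M U" using L exp_type_indep_summand[OF ind] by (simp add: L_def[abs_def])
  have R: "exp_type M R"
    using L exp_type_indep_summand[OF indep_var_swap[OF ind]] by (simp add: L_def[abs_def] add.commute)
  define F where "F X z = expectation (\<lambda>x. exp (z * complex_of_real (X x)))" for X z
  have FL: "F L z = F U z * F R z" for z
  proof -
    have "F L z = expectation (\<lambda>x. exp (z * complex_of_real (U x)) * exp (z * complex_of_real (R x)))"
      by (simp add: F_def L_def distrib_left exp_add)
    also have "\<dots> = F U z * F R z" unfolding F_def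
      by (intro indep_var_lebesgue_integral indep_var_compose[unfolded comp_def, OF ind]
          exp_type_integrable(2) U R) auto
    finally show ?thesis .
  qed
  have hol: "F L holomorphic_on UNIV" "F U holomorphic_on UNIV"
    using exp_type_holomorphic[OF L] exp_type_holomorphic[OF U] by (simp_all add: F_def[abs_def])
  \<comment> \<open>Evaluating at \<open>- \<i> * z\<close> makes the argument equal to
    \<open>t\<close> when \<open>z = \<i> * t\<close>.\<close>
  define Pc where "Pc = map_poly complex_of_real P"
  have "F L z * F L (- z) - exp (poly Pc (- \<i> * z)) = 0" for z
  proof (rule analytic_continuation[where f = "\<lambda>z. F L z * F L (- z) - exp (poly Pc (- \<i> * z))"
        and S = UNIV and U = "(\<lambda>t. \<i> * complex_of_real t) ` {0<..<\<epsilon>}" and \<xi> = 0])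
    have "(\<lambda>z::complex. - z) holomorphic_on UNIV" by (intro holomorphic_intros)
    from holomorphic_on_compose_gen[OF this hol(1)] have "(\<lambda>z. F L (- z)) holomorphic_on UNIV"
      by (simp add: o_def)
    then show "(\<lambda>z. F L z * F L (- z) - exp (poly Pc (- \<i> * z))) holomorphic_on UNIV"
      by (intro holomorphic_intros hol)
    show "0 islimpt (\<lambda>t. \<i> * complex_of_real t) ` {0<..<\<epsilon>}"
      unfolding islimpt_approachable
    proof (intro allI impI)
      fix r :: real assume r: "r > 0"
      define s where "s = min r \<epsilon> / 2"
      have s: "0 < s" "s < \<epsilon>" "s < r" using r \<epsilon> by (auto simp: s_def)
      show "\<exists>x'\<in>(\<lambda>t. \<i> * complex_of_real t) ` {0<..<\<epsilon>}. x' \<noteq> 0 \<and> dist x' 0 < r"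
        by (rule bexI[of _ "\<i> * complex_of_real s"]) (use s in \<open>auto simp: norm_mult\<close>)
    qed
    fix z assume "z \<in> (\<lambda>t. \<i> * complex_of_real t) ` {0<..<\<epsilon>}"
    then obtain t where t: "z = \<i> * complex_of_real t" "0 < t" "t < \<epsilon>" by auto
    have 1: "F L z = char (distr M borel L) t" by (simp add: F_def char_distr_eq_expectation t mult.assoc)
    have 2: "F L (- z) = cnj (char (distr M borel L) t)"
    proof -
      have "F L (- z) = expectation (\<lambda>x. cnj (iexp (t * L x)))"
        by (simp add: F_def t exp_cnj mult.assoc del: integral_cnj)
      then show ?thesis by (simp add: char_def integral_distr)
    qed
    have "F L z * F L (- z) = complex_of_real (exp (poly P t))"
      using P[of t] t unfolding 1 2 by (simp add: complex_norm_square[symmetric] L_def[abs_def] flip: of_real_power)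
    moreover have "poly Pc (- \<i> * z) = complex_of_real (poly P t)"
    proof -
      have "- \<i> * z = complex_of_real t" by (simp add: t)
      then show ?thesis unfolding Pc_def by (simp only: poly_map_poly_of_real)
    qed
    ultimately show "F L z * F L (- z) - exp (poly Pc (- \<i> * z)) = 0" by (simp add: exp_of_real)
  qed auto
  then have nz: "F U z \<noteq> 0" for z
    using FL[of z] by (metis diff_eq_diff_eq exp_not_eq_zero mult_zero_left cancel_comm_monoid_add_class.diff_cancel)
  obtain B m where "\<And>z. norm (F U z) \<le> exp (B * (1 + norm z) ^ m)"
    using exp_type_growth[OF U] unfolding F_def by blast
  then obtain Q where Q: "\<And>z. F U z = exp (poly Q z)"
    using zero_free_entire_is_exp_polynomial[OF hol(2) nz] by blast
  \<comment> \<open>\<open>norm (F U z)\<close> is at most \<open>F U\<close> at the real part of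
    \<open>z\<close>; taking logarithms gives the ridge inequality for \<open>Q\<close>.\<close>
  have "Re (poly Q z) \<le> Re (poly Q (complex_of_real (Re z)))" for z
  proof -
    have "norm (F U z) \<le> expectation (\<lambda>x. exp (Re z * U x))"
      using integral_norm_bound[of M "\<lambda>x. exp (z * complex_of_real (U x))"] by (simp add: F_def)
    also have "F U (complex_of_real (Re z)) = expectation (\<lambda>x. complex_of_real (exp (Re z * U x)))"
      by (simp only: F_def of_real_mult[symmetric] exp_of_real)
    then have "F U (complex_of_real (Re z)) = complex_of_real (expectation (\<lambda>x. exp (Re z * U x)))"
      by (simp only: integral_complex_of_real)
    then have "expectation (\<lambda>x. exp (Re z * U x)) \<le> norm (F U (complex_of_real (Re z)))"
      by (metis abs_ge_self norm_of_real)
    finally show ?thesis by (simp add: Q)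
  qed
  then have "degree Q \<le> 2" by (rule marcinkiewicz_polynomial)
  then show ?thesis using Q unfolding F_def by blast
qed

text \<open>The complex coefficients are restricted by what holds for every characteristic function:
  modulus at most \<open>1\<close> makes \<open>Re (q 2)\<close> nonnegative and \<open>q 1\<close>
  real, and Hermitian symmetry makes \<open>q 2\<close> real. The number \<open>v\<close> is half of
  the variance.\<close>

lemma char_of_quadratic_mgf:
  assumes [measurable]: "U \<in> borel_measurable M"
    and Q: "degree Q \<le> 2" "\<And>z. expectation (\<lambda>x. exp (z * complex_of_real (U x))) = exp (poly Q z)"
  shows "\<exists>\<mu> v. v \<ge> 0 \<and> (\<forall>t. char (distr M borel U) t = exp (\<i> * complex_of_real (\<mu> * t) - complex_of_real (v * t\<^sup>2)))"
proof -
  interpret D: real_distribution "distr M borel U"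
    by (rule real_distribution_distr) measurable
  define q where "q = coeff Q"
  have pQ: "poly Q z = q 0 + q 1 * z + q 2 * z\<^sup>2" for z
  proof -
    have "poly Q z = (\<Sum>i\<le>2. coeff Q i * z ^ i)"
      unfolding poly_altdef using Q(1) by (intro sum.mono_neutral_left) (auto simp: coeff_eq_0)
    then show ?thesis by (simp add: q_def numeral_2_eq_2)
  qed
  \<comment> \<open>Total mass \<open>1\<close> fixes \<open>q 0\<close> only up to multiples of
    \<open>2 pi \<i>\<close>, hence the statement about its exponential.\<close>
  have q0: "exp (q 0) = 1" using Q(2)[of 0] pQ[of 0] by (simp add: prob_space)
  have ch: "char (distr M borel U) t = exp (\<i> * q 1 * t - q 2 * t\<^sup>2)" for t
  proof -
    have "char (distr M borel U) t = exp (poly Q (\<i> * t))"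
      by (simp add: char_distr_eq_expectation flip: Q(2))
    also have "poly Q (\<i> * t) = q 0 + (\<i> * q 1 * t - q 2 * t\<^sup>2)"
      by (simp add: pQ power_mult_distrib)
    finally show ?thesis using q0 by (simp only: exp_add mult_1)
  qed
  have le: "- Im (q 1) * t - Re (q 2) * t\<^sup>2 \<le> 0" for t
  proof -
    have "exp (- Im (q 1) * t - Re (q 2) * t\<^sup>2) \<le> 1"
      using D.cmod_char_le_1[of t] unfolding ch norm_exp_eq_Re by (simp flip: of_real_power)
    then show ?thesis by simp
  qed
  have "Re (q 2) \<ge> 0" using le[of 1] le[of "- 1"] by simp
  have im1: "Im (q 1) = 0"
  proof (rule ccontr)
    assume nz: "Im (q 1) \<noteq> 0"
    \<comment> \<open>Adding \<open>1\<close> avoids division by zero when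
      \<open>Re (q 2) = 0\<close>; at \<open>s = - Im (q 1) / w\<close> the quadratic still takes
      the positive value \<open>(Im (q 1) / w)^2\<close>.\<close>
    define w where "w = Re (q 2) + 1"
    have w: "w > 0" "Re (q 2) = w - 1" using \<open>Re (q 2) \<ge> 0\<close> by (auto simp: w_def)
    define s where "s = - Im (q 1) / w"
    have "- Im (q 1) * s - Re (q 2) * s\<^sup>2 = (Im (q 1))\<^sup>2 / w\<^sup>2"
      unfolding w(2) using w(1) by (simp add: s_def field_simps power2_eq_square)
    also have "\<dots> > 0" using nz w(1) by simp
    finally show False using le[of s] by simp
  qed
  have im2: "Im (q 2) = 0"
  proof (rule ccontr)
    assume nz: "Im (q 2) \<noteq> 0"
    \<comment> \<open>Chosen so that \<open>2 * Im (q 2) * s^2\<close> is \<open>pi / 2\<close> up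
      to sign, where the sine is nonzero, although the product of the values at \<open>s\<close> and
      \<open>- s\<close> must be real.\<close>
    define s where "s = sqrt (pi / (4 * \<bar>Im (q 2)\<bar>))"
    have s2: "s\<^sup>2 = pi / (4 * \<bar>Im (q 2)\<bar>)" by (simp add: s_def)
    have "char (distr M borel U) (- s) = cnj (char (distr M borel U) s)"
    proof -
      have "char (distr M borel U) (- s) = expectation (\<lambda>x. cnj (iexp (s * U x)))"
        by (simp add: char_def integral_distr exp_cnj del: integral_cnj)
      then show ?thesis by (simp add: char_def integral_distr)
    qed
    then have "Im (char (distr M borel U) s * char (distr M borel U) (- s)) = 0"
      by (simp add: complex_norm_square[symmetric] flip: of_real_power)
    moreover have "char (distr M borel U) s * char (distr M borel U) (- s) = exp (- (2 * q 2 * s\<^sup>2))"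
      by (simp add: ch mult.assoc flip: exp_add of_real_power)
    ultimately have "sin (2 * Im (q 2) * s\<^sup>2) = 0" by (simp add: Im_exp flip: of_real_power)
    moreover have "2 * Im (q 2) * s\<^sup>2 = pi / 2 \<or> 2 * Im (q 2) * s\<^sup>2 = - (pi / 2)"
      unfolding s2 using nz by (cases "Im (q 2) > 0") (auto simp: field_simps)
    then have "sin (2 * Im (q 2) * s\<^sup>2) = 1 \<or> sin (2 * Im (q 2) * s\<^sup>2) = - 1"
      by (metis sin_minus sin_pi_half)
    ultimately show False by auto
  qed
  have "char (distr M borel U) t = exp (\<i> * complex_of_real (Re (q 1) * t) - complex_of_real (Re (q 2) * t\<^sup>2))" for t
  proof -
    have "q 1 = complex_of_real (Re (q 1))" "q 2 = complex_of_real (Re (q 2))"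
      using im1 im2 by (simp_all add: complex_eq_iff)
    then show ?thesis unfolding ch by (metis mult.assoc of_real_mult of_real_power)
  qed
  then show ?thesis using \<open>Re (q 2) \<ge> 0\<close> by blast
qed

text \<open>Only \<open>ln \<bar>\<phi>\<^sub>i\<bar>\<close> is used, so that no complex logarithm is needed. The summands are grouped by the
  ratio \<open>b i / a i\<close>: for a single group the ridge theorem makes the logarithm of the product polynomial
  near \<open>0\<close>, and the decomposition lemma above then applies to each member of the group.\<close>

theorem darmois_skitovich:
  fixes e :: "'i \<Rightarrow> 'a \<Rightarrow> real"
  assumes fin: "finite I" and indep: "indep_vars (\<lambda>_. borel) e I"
    and ind: "indep_var borel (\<lambda>x. \<Sum>i\<in>I. a i * e i x) borel (\<lambda>x. \<Sum>i\<in>I. b i * e i x)"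
    and k: "k \<in> I" "a k \<noteq> 0" "b k \<noteq> 0"
  shows "\<exists>\<mu> v. v \<ge> 0 \<and> (\<forall>t. char (distr M borel (e k)) t = exp (\<i> * complex_of_real (\<mu> * t) - complex_of_real (v * t\<^sup>2)))"
proof -
  have rv: "e i \<in> borel_measurable M" if "i \<in> I" for i
    using indep that by (auto simp: indep_vars_def)
  define \<phi> where "\<phi> i = char (distr M borel (e i))" for i
  have char_lin: "char (distr M borel (\<lambda>x. \<Sum>i\<in>J. c i * e i x)) t = (\<Prod>i\<in>J. \<phi> i (c i * t))"
    if "J \<subseteq> I" for J c t
  proof -
    have "indep_vars (\<lambda>_. borel) (\<lambda>i x. c i * e i x) J"
      by (rule indep_vars_compose2[OF indep_vars_subset[OF indep that]]) auto
    then have "char (distr M borel (\<lambda>x. \<Sum>i\<in>J. c i * e i x)) t = (\<Prod>i\<in>J. char (distr M borel (\<lambda>x. c i * e i x)) t)"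
      by (rule char_distr_sum)
    also have "\<dots> = (\<Prod>i\<in>J. \<phi> i (c i * t))"
      using that rv by (intro prod.cong) (auto simp: \<phi>_def char_distr_scale)
    finally show ?thesis .
  qed
  \<comment> \<open>Both sides are the joint characteristic function of the two forms at
    \<open>(x, y)\<close>: the left by independence of the noises, the right by independence of the
    forms.\<close>
  have prod_eq: "(\<Prod>i\<in>I. \<phi> i (a i * x + b i * y)) = (\<Prod>i\<in>I. \<phi> i (a i * x)) * (\<Prod>i\<in>I. \<phi> i (b i * y))" for x y
  proof -
    define L1 where "L1 \<omega> = (\<Sum>i\<in>I. a i * e i \<omega>)" for \<omega>
    define L2 where "L2 \<omega> = (\<Sum>i\<in>I. b i * e i \<omega>)" for \<omega>
    have [measurable]: "L1 \<in> borel_measurable M" "L2 \<in> borel_measurable M"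
      unfolding L1_def L2_def using rv by (auto intro!: borel_measurable_sum borel_measurable_times)
    have "indep_var borel (\<lambda>\<omega>. x * L1 \<omega>) borel (\<lambda>\<omega>. y * L2 \<omega>)"
      using indep_var_compose[OF ind, of "\<lambda>u. x * u" borel "\<lambda>u. y * u" borel]
      by (simp add: comp_def L1_def L2_def)
    from char_distr_add[OF this, of 1]
    have "char (distr M borel (\<lambda>\<omega>. x * L1 \<omega> + y * L2 \<omega>)) 1 = char (distr M borel L1) x * char (distr M borel L2) y"
      by (simp add: char_distr_scale)
    moreover have "x * L1 \<omega> + y * L2 \<omega> = (\<Sum>i\<in>I. (a i * x + b i * y) * e i \<omega>)" for \<omega>
      by (simp add: L1_def L2_def sum_distrib_left sum.distrib algebra_simps)
    ultimately show ?thesis by (simp add: L1_def[abs_def] L2_def[abs_def] char_lin)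
  qed
  \<comment> \<open>Continuity and the value \<open>1\<close> at \<open>0\<close> keep all
    \<open>\<phi> i\<close> away from zero near \<open>0\<close>, so that the logarithms
    \<open>l i\<close> satisfy the additive form of \<open>prod_eq\<close> there.\<close>
  have \<phi>: "isCont (\<phi> i) t" "\<phi> i 0 = 1" if "i \<in> I" for i t
  proof -
    interpret D: real_distribution "distr M borel (e i)"
      using rv[OF that] by (rule real_distribution_distr)
    show "isCont (\<phi> i) t" "\<phi> i 0 = 1" unfolding \<phi>_def by (rule D.isCont_char D.char_zero)+
  qed
  have "\<forall>\<^sub>F t in nhds 0. \<forall>i\<in>I. \<phi> i t \<noteq> 0"
    unfolding eventually_ball_finite_distrib[OF fin]
  proof
    fix i assume i: "i \<in> I"
    have "(\<phi> i \<longlongrightarrow> 1) (nhds 0)"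
      using \<phi>[OF i] isCont_def tendsto_at_iff_tendsto_nhds by metis
    then show "\<forall>\<^sub>F t in nhds 0. \<phi> i t \<noteq> 0" by (rule tendsto_imp_eventually_ne) simp
  qed
  then obtain \<delta>0 where \<delta>0: "\<delta>0 > 0" and nz: "\<And>i t. i \<in> I \<Longrightarrow> \<bar>t\<bar> < \<delta>0 \<Longrightarrow> \<phi> i t \<noteq> 0"
    by (auto simp: eventually_nhds_metric)
  define C where "C = 1 + (\<Sum>i\<in>I. \<bar>a i\<bar> + \<bar>b i\<bar>)"
  have C1: "C \<ge> 1" unfolding C_def by (simp add: sum_nonneg)
  have C: "\<bar>a i\<bar> + \<bar>b i\<bar> \<le> C" if "i \<in> I" for i
    unfolding C_def using member_le_sum[of i I "\<lambda>i. \<bar>a i\<bar> + \<bar>b i\<bar>"] fin that by simp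
  define \<delta> where "\<delta> = \<delta>0 / C"
  have \<delta>: "\<delta> > 0" using \<delta>0 C1 by (simp add: \<delta>_def)
  have small: "\<bar>a i * x + b i * y\<bar> < \<delta>0" if "i \<in> I" "\<bar>x\<bar> < \<delta>" "\<bar>y\<bar> < \<delta>" for i x y
  proof -
    let ?m = "max \<bar>x\<bar> \<bar>y\<bar>"
    have "\<bar>a i * x + b i * y\<bar> \<le> \<bar>a i\<bar> * ?m + \<bar>b i\<bar> * ?m"
      by (intro order_trans[OF abs_triangle_ineq] add_mono) (auto simp: abs_mult intro!: mult_left_mono)
    also have "\<dots> \<le> C * ?m" using C[OF that(1)] by (auto simp flip: distrib_right intro!: mult_right_mono)
    also have "\<dots> < C * \<delta>" using C1 that by (intro mult_strict_left_mono) auto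
    finally show ?thesis using C1 by (simp add: \<delta>_def)
  qed
  define l where "l i t = ln (norm (\<phi> i t))" for i t
  \<comment> \<open>Summands with a zero coefficient cancel from the functional equation because
    \<open>l i 0 = 0\<close>. Those that remain have a ratio \<open>b i / a i\<close> that is
    defined and nonzero.\<close>
  define K where "K = {i \<in> I. a i \<noteq> 0 \<and> b i \<noteq> 0}"
  have K: "finite K" "K \<subseteq> I" "k \<in> K" using fin k by (auto simp: K_def)
  have l_eq: "(\<Sum>i\<in>K. l i (a i * x + b i * y)) = (\<Sum>i\<in>K. l i (a i * x)) + (\<Sum>i\<in>K. l i (b i * y))"
    if x: "\<bar>x\<bar> < \<delta>" and y: "\<bar>y\<bar> < \<delta>" for x y
  proof -
    have ln_prod: "ln (norm (\<Prod>i\<in>I. \<phi> i (c i))) = (\<Sum>i\<in>I. l i (c i))" if "\<And>i. i \<in> I \<Longrightarrow> \<phi> i (c i) \<noteq> 0" for c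
      using fin that by (simp add: l_def ln_prod flip: prod_norm)
    have n: "\<phi> i (a i * x + b i * y) \<noteq> 0" "\<phi> i (a i * x) \<noteq> 0" "\<phi> i (b i * y) \<noteq> 0" if "i \<in> I" for i
      using small[OF that x y] small[OF that x, of 0] small[OF that _ y, of 0] \<delta> nz[OF that] by auto
    have "ln (norm (\<Prod>i\<in>I. \<phi> i (a i * x + b i * y)))
        = ln (norm (\<Prod>i\<in>I. \<phi> i (a i * x))) + ln (norm (\<Prod>i\<in>I. \<phi> i (b i * y)))"
      unfolding prod_eq norm_mult using n fin by (intro ln_mult_pos) auto
    then have "(\<Sum>i\<in>I. l i (a i * x + b i * y) - l i (a i * x) - l i (b i * y)) = 0"
      using n by (simp add: ln_prod sum_subtractf)
    also have "(\<Sum>i\<in>I. l i (a i * x + b i * y) - l i (a i * x) - l i (b i * y))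
       = (\<Sum>i\<in>K. l i (a i * x + b i * y) - l i (a i * x) - l i (b i * y))"
      using fin \<phi>(2) by (intro sum.mono_neutral_right) (auto simp: K_def l_def)
    finally show ?thesis by (simp add: sum_subtractf)
  qed
  define r where "r i = (1 :: real, b i / a i)" for i
  define G where "G d = {i \<in> K. r i = d}" for d
  \<comment> \<open>The two axes carry the right-hand side of the functional equation, moved to the
    left with a minus sign. No \<open>r i\<close> with \<open>i\<close> in \<open>K\<close> is an
    axis, so the directions in \<open>D\<close> are pairwise non-parallel.\<close>
  define D where "D = insert (1, 0) (insert (0, 1) (r ` K))"
  have rD: "r i \<noteq> (1, 0)" "r i \<noteq> (0, 1)" if "i \<in> K" for i
    using that by (auto simp: r_def K_def)
  define f where "f d t = (if d = (1, 0) then - (\<Sum>i\<in>K. l i (a i * t)) else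
     if d = (0, 1) then - (\<Sum>i\<in>K. l i (b i * t)) else (\<Sum>i\<in>G d. l i (a i * t)))" for d t
  have "\<exists>P. \<exists>\<epsilon>>0. \<forall>t. \<bar>t\<bar> < \<epsilon> \<longrightarrow> f (r k) t = poly P t"
  proof (rule ridge_sum_imp_polynomial[where D = D and \<delta> = \<delta>])
    show "finite D" "0 \<notin> D" "r k \<in> D" using K by (auto simp: D_def r_def zero_prod_def)
    show "fst d * snd e - snd d * fst e \<noteq> 0" if "d \<in> D" "e \<in> D" "d \<noteq> e" for d e
      using that rD by (auto simp: D_def r_def)
    show "\<delta> > 0" by fact
    show "isCont (f d) t" if "d \<in> D" "\<bar>t\<bar> < \<delta>" for d t
    proof -
      have c: "isCont (\<lambda>t. l i (c * t)) t" if "i \<in> K" "c \<in> {a i, b i}" for i c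
      proof -
        have i: "i \<in> I" using that K by auto
        have "\<bar>c * t\<bar> < \<delta>0"
          using small[OF i \<open>\<bar>t\<bar> < \<delta>\<close>, of 0] small[OF i, of 0 t] \<open>\<bar>t\<bar> < \<delta>\<close> \<delta> that by auto
        then have "\<phi> i (c * t) \<noteq> 0" using nz i by blast
        moreover have "isCont (\<lambda>t. \<phi> i (c * t)) t"
          by (rule isCont_o2[of t "\<lambda>t. c * t" "\<phi> i"]) (auto intro!: \<phi> i)
        ultimately show ?thesis unfolding l_def by (intro continuous_intros) auto
      qed
      consider "d = (1, 0)" | "d = (0, 1)" | "d \<noteq> (1, 0)" "d \<noteq> (0, 1)" by blast
      then show ?thesis
      proof cases
        case 1
        then have "f d = (\<lambda>t. - (\<Sum>i\<in>K. l i (a i * t)))" by (simp add: f_def fun_eq_iff)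
        then show ?thesis using c by (intro ssubst[of "f d" _ "\<lambda>f. isCont f t"] continuous_intros) auto
      next
        case 2
        then have "f d = (\<lambda>t. - (\<Sum>i\<in>K. l i (b i * t)))" by (simp add: f_def fun_eq_iff)
        then show ?thesis using c by (intro ssubst[of "f d" _ "\<lambda>f. isCont f t"] continuous_intros) auto
      next
        case 3
        then have "f d = (\<lambda>t. \<Sum>i\<in>G d. l i (a i * t))" by (simp add: f_def fun_eq_iff)
        then show ?thesis using c
          by (intro ssubst[of "f d" _ "\<lambda>f. isCont f t"] continuous_intros) (auto simp: G_def)
      qed
    qed
    show "(\<Sum>d\<in>D. f d (fst d * x + snd d * y)) = 0" if x: "\<bar>x\<bar> < \<delta>" and y: "\<bar>y\<bar> < \<delta>" for x y
    proof -
      have n: "(1, 0) \<notin> insert (0, 1) (r ` K)" "(0, 1) \<notin> r ` K" using imageE[of "(1, 0)" r K] imageE[of "(0, 1)" r K] rD by auto metis+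
      have "(\<Sum>d\<in>D. f d (fst d * x + snd d * y)) = f (1, 0) x + (f (0, 1) y + (\<Sum>d\<in>r ` K. f d (fst d * x + snd d * y)))"
        using n K by (simp add: D_def)
      also have "(\<Sum>d\<in>r ` K. f d (fst d * x + snd d * y)) = (\<Sum>d\<in>r ` K. \<Sum>i\<in>G d. l i (a i * x + b i * y))"
      proof (rule sum.cong[OF refl])
        fix d assume d: "d \<in> r ` K"
        have "f d (fst d * x + snd d * y) = (\<Sum>i\<in>G d. l i (a i * (fst d * x + snd d * y)))"
        proof -
          have "d \<noteq> (1, 0)" "d \<noteq> (0, 1)" using d n by blast+
          then show ?thesis by (simp add: f_def)
        qed
        also have "\<dots> = (\<Sum>i\<in>G d. l i (a i * x + b i * y))"
          by (rule sum.cong[OF refl]) (auto simp: G_def r_def K_def distrib_left)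
        finally show "f d (fst d * x + snd d * y) = (\<Sum>i\<in>G d. l i (a i * x + b i * y))" .
      qed
      also have "\<dots> = (\<Sum>i\<in>K. l i (a i * x + b i * y))"
        unfolding G_def using K by (intro sum.group) auto
      finally show ?thesis using l_eq[OF x y] by (simp add: f_def)
    qed
  qed
  then obtain P \<epsilon> where \<epsilon>: "\<epsilon> > 0" and P: "\<And>t. \<bar>t\<bar> < \<epsilon> \<Longrightarrow> f (r k) t = poly P t" by blast
  define H where "H = G (r k)"
  have H: "finite H" "H \<subseteq> I" "k \<in> H" using K by (auto simp: H_def G_def)
  define U where "U x = a k * e k x" for x
  define R where "R x = (\<Sum>i\<in>H - {k}. a i * e i x)" for x
  have UR: "indep_var borel U borel R"
    unfolding U_def[abs_def] R_def[abs_def]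
  proof (rule indep_vars_sum)
    have "insert k (H - {k}) = H" using H by auto
    then show "indep_vars (\<lambda>_. borel) (\<lambda>i x. a i * e i x) (insert k (H - {k}))"
      using indep_vars_compose2[OF indep_vars_subset[OF indep H(2)], of "\<lambda>i u. a i * u" "\<lambda>_. borel"] by simp
  qed (use H in auto)
  have "(norm (char (distr M borel (\<lambda>x. U x + R x)) t))\<^sup>2 = exp (poly (Polynomial.smult 2 P) t)" if t: "\<bar>t\<bar> < min \<epsilon> \<delta>" for t
  proof -
    have "U x + R x = (\<Sum>i\<in>H. a i * e i x)" for x
      using H by (simp add: U_def R_def sum.remove)
    then have "norm (char (distr M borel (\<lambda>x. U x + R x)) t) = (\<Prod>i\<in>H. norm (\<phi> i (a i * t)))"
      using H by (simp add: char_lin prod_norm)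
    also have "\<dots> = (\<Prod>i\<in>H. exp (l i (a i * t)))"
    proof (rule prod.cong[OF refl])
      fix i assume "i \<in> H"
      then have i: "i \<in> I" using H by auto
      then have "\<phi> i (a i * t) \<noteq> 0" using small[OF i, of t 0] t \<delta> nz by auto
      then show "norm (\<phi> i (a i * t)) = exp (l i (a i * t))" by (simp add: l_def)
    qed
    also have "\<dots> = exp (\<Sum>i\<in>H. l i (a i * t))" using H by (simp add: exp_sum)
    also have "(\<Sum>i\<in>H. l i (a i * t)) = poly P t"
      using P[of t] t rD[OF K(3)] by (simp add: f_def H_def)
    finally show ?thesis by (simp flip: exp_double)
  qed
  then obtain Q where "degree Q \<le> 2" "\<And>z. expectation (\<lambda>x. exp (z * complex_of_real (U x))) = exp (poly Q z)"
    using summand_mgf_exp_quadratic[OF UR, of "min \<epsilon> \<delta>" "Polynomial.smult 2 P"] \<epsilon> \<delta> by auto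
  then obtain \<mu> v where v: "v \<ge> 0"
    and U: "\<And>t. char (distr M borel U) t = exp (\<i> * complex_of_real (\<mu> * t) - complex_of_real (v * t\<^sup>2))"
    using char_of_quadratic_mgf[of U Q] UR by (auto dest: indep_var_rv1)
  have "char (distr M borel (e k)) t = exp (\<i> * complex_of_real (\<mu> / a k * t) - complex_of_real (v / (a k)\<^sup>2 * t\<^sup>2))" for t
    using U[of "t / a k"] char_distr_scale[OF rv[OF k(1)], of "a k" "t / a k"] k
    by (simp add: U_def[abs_def] power_divide)
  then show ?thesis using v by (intro exI[of _ "\<mu> / a k"] exI[of _ "v / (a k)\<^sup>2"]) auto
qed

text \<open>By Levy's uniqueness theorem it suffices to compare with an affine image of a standard
  normal variable. The deviation is \<open>sqrt (2 * v)\<close> because \<open>v\<close> is half of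
  the variance.\<close>

lemma gaussian_of_char:
  assumes [measurable]: "U \<in> borel_measurable M"
    and v: "v > 0" and ch: "\<And>t. char (distr M borel U) t = exp (\<i> * complex_of_real (\<mu> * t) - complex_of_real (v * t\<^sup>2))"
  shows "distributed M lborel U (normal_density \<mu> (sqrt (2 * v)))"
proof -
  define \<sigma> where "\<sigma> = sqrt (2 * v)"
  have \<sigma>: "\<sigma> > 0" "\<sigma>\<^sup>2 = 2 * v" using v by (auto simp: \<sigma>_def)
  interpret S: real_distribution std_normal_distribution by (rule real_dist_normal_dist)
  have "distributed std_normal_distribution lborel (\<lambda>x. x) std_normal_density"
    by (auto simp: distributed_def distr_id2)
  from S.normal_density_affine[OF this, of \<sigma> \<mu>] \<sigma>
  have d: "distributed std_normal_distribution lborel (\<lambda>x. \<mu> + \<sigma> * x) (normal_density \<mu> \<sigma>)" by simp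
  have "distr M borel U = distr std_normal_distribution borel (\<lambda>x. \<mu> + \<sigma> * x)"
  proof (rule Levy_uniqueness)
    show "real_distribution (distr M borel U)" by (rule real_distribution_distr) measurable
    show "real_distribution (distr std_normal_distribution borel (\<lambda>x. \<mu> + \<sigma> * x))"
      by (rule S.real_distribution_distr) auto
    show "char (distr M borel U) = char (distr std_normal_distribution borel (\<lambda>x. \<mu> + \<sigma> * x))"
    proof
      fix t
      have "char (distr std_normal_distribution borel (\<lambda>x. \<mu> + \<sigma> * x)) t
          = (CLINT x|std_normal_distribution. iexp (\<mu> * t) * iexp (\<sigma> * t * x))"
        by (simp add: char_def integral_distr algebra_simps flip: exp_add)
      also have "\<dots> = iexp (\<mu> * t) * char std_normal_distribution (\<sigma> * t)"
        by (simp add: char_def)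
      also have "char std_normal_distribution (\<sigma> * t) = exp (- complex_of_real (v * t\<^sup>2))"
      proof -
        have "- (\<sigma> * t)\<^sup>2 / 2 = - (v * t\<^sup>2)" by (simp add: power_mult_distrib \<sigma>)
        then have "char std_normal_distribution (\<sigma> * t) = complex_of_real (exp (- (v * t\<^sup>2)))"
          by (simp only: char_std_normal_distribution)
        then show ?thesis by (metis exp_of_real of_real_minus)
      qed
      also have "iexp (\<mu> * t) * exp (- complex_of_real (v * t\<^sup>2)) = exp (\<i> * complex_of_real (\<mu> * t) - complex_of_real (v * t\<^sup>2))"
        by (simp only: mult_exp_exp diff_conv_add_uminus)
      finally show "char (distr M borel U) t = char (distr std_normal_distribution borel (\<lambda>x. \<mu> + \<sigma> * x)) t"
        by (simp only: ch)
    qed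
  qed
  also have "distr std_normal_distribution borel (\<lambda>x. \<mu> + \<sigma> * x) = distr std_normal_distribution lborel (\<lambda>x. \<mu> + \<sigma> * x)"
    by (rule distr_cong) auto
  also have "\<dots> = density lborel (normal_density \<mu> \<sigma>)" using d by (simp add: distributed_def)
  finally have "distr M borel U = density lborel (normal_density \<mu> \<sigma>)" .
  moreover have "distr M lborel U = distr M borel U" by (rule distr_cong) auto
  ultimately show ?thesis by (auto simp: distributed_def \<sigma>_def)
qed

text \<open>This is the characteristic function of the point mass at \<open>\<mu>\<close>, so
  \<open>U\<close> is almost surely constant.\<close>

lemma variance_zero_of_char:
  assumes [measurable]: "U \<in> borel_measurable M"
    and ch: "\<And>t. char (distr M borel U) t = exp (\<i> * complex_of_real (\<mu> * t))"
  shows "variance U = 0"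
proof -
  have eq: "distr M borel U = return borel \<mu>"
  proof (rule Levy_uniqueness)
    show "real_distribution (distr M borel U)" by (rule real_distribution_distr) measurable
    show "real_distribution (return borel \<mu>)"
      by (simp add: real_distribution_def real_distribution_axioms_def prob_space_return)
    show "char (distr M borel U) = char (return borel \<mu>)"
    proof
      fix t
      have "char (return borel \<mu>) t = exp (\<i> * complex_of_real (\<mu> * t))"
        by (simp add: char_def integral_return mult.commute)
      then show "char (distr M borel U) t = char (return borel \<mu>) t" by (simp only: ch)
    qed
  qed
  have "AE x in distr M borel U. x = \<mu>"
    unfolding eq by (subst AE_return) auto
  then have ae: "AE x in M. U x = \<mu>" by (simp add: AE_distr_iff)
  then have "expectation U = expectation (\<lambda>_. \<mu>)" by (intro integral_cong_AE) auto
  then have "expectation U = \<mu>" by (simp add: prob_space)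
  then have "AE x in M. (U x - expectation U)\<^sup>2 = 0" using ae by auto
  then have "variance U = expectation (\<lambda>_. 0)" by (intro integral_cong_AE) auto
  then show ?thesis by simp
qed

end

section \<open>Linear non-Gaussian models\<close>

text \<open>The rank counts independent columns, so \<open>n\<close> columns of \<open>A\<close>
  form an invertible square matrix \<open>C\<close>. Being orthogonal to them means lying in the
  kernel of the transpose of \<open>C\<close>, which is trivial.\<close>

lemma full_row_rank_left_kernel:
  fixes A :: "real mat"
  assumes A: "A \<in> carrier_mat n m" and rank: "vec_space.rank n A = n"
    and w: "w \<in> carrier_vec n" "\<And>j. j < m \<Longrightarrow> col A j \<bullet> w = 0"
  shows "w = 0\<^sub>v n"
proof -
  interpret V: vec_space "TYPE(real)" n .
  obtain B where B: "maximal B (\<lambda>T. T \<subseteq> set (cols A) \<and> V.lin_indpt T)"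
    using maximal_exists[of "\<lambda>T. T \<subseteq> set (cols A) \<and> V.lin_indpt T" "card (set (cols A))" "{}"]
    by (meson List.finite_set card_mono empty_iff empty_subsetI V.finite_lin_indpt2 rev_finite_subset)
  have Bsub: "B \<subseteq> set (cols A)" "V.lin_indpt B" using B by (auto simp: maximal_def)
  have cB: "card B = n" using V.rank_card_indpt[OF A B] rank by simp
  have carr: "set (cols A) \<subseteq> carrier_vec n" using cols_dim[of A] A by auto
  obtain bs where bs: "set bs = B" "distinct bs"
    using finite_distinct_list[of B] Bsub(1) finite_subset by blast
  then have len: "length bs = n" using cB distinct_card by metis
  define C where "C = mat_of_cols n bs"
  have C: "C \<in> carrier_mat n n" using len by (auto simp: C_def)
  have colsC: "cols C = bs"
    unfolding C_def using bs Bsub carr by (intro cols_mat_of_cols) auto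
  have "V.rank C = n"
    by (rule V.lin_indpt_full_rank[OF C]) (use bs Bsub in \<open>auto simp: colsC\<close>)
  then have "det C \<noteq> 0" using V.det_rank_iff[OF C] by simp
  then have "det (transpose_mat C) \<noteq> 0" using det_transpose[OF C] by simp
  moreover have "transpose_mat C *\<^sub>v w = 0\<^sub>v n"
  proof (rule eq_vecI)
    fix i assume "i < dim_vec (0\<^sub>v n :: real vec)"
    then have i: "i < n" by simp
    have "bs ! i \<in> set (cols A)" using i len bs Bsub by (metis nth_mem subsetD)
    then obtain j where j: "j < m" "bs ! i = col A j" using A by (auto simp: cols_def)
    have "col C i = bs ! i" using colsC i C by (metis cols_nth carrier_matD(2))
    then show "(transpose_mat C *\<^sub>v w) $ i = 0\<^sub>v n $ i" using i C w(2)[OF j(1)] j by simp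
  qed (use C in simp)
  moreover have "transpose_mat C \<in> carrier_mat n n" using C by simp
  ultimately show ?thesis using det_0_iff_vec_prod_zero w(1) by blast
qed

text \<open>Padding with zero columns to a \<open>p\<close> by \<open>p\<close> matrix leaves column
  \<open>p - 1\<close> zero because \<open>s < p\<close>. The determinant vanishes, hence the
  transpose has a nontrivial kernel.\<close>

lemma left_kernel_nontrivial:
  fixes A :: "real mat"
  assumes A: "A \<in> carrier_mat p s" and "s < p"
  shows "\<exists>w. w \<in> carrier_vec p \<and> w \<noteq> 0\<^sub>v p \<and> (\<forall>j<s. (\<Sum>i<p. w $ i * A $$ (i, j)) = 0)"
proof -
  define A' where "A' = mat p p (\<lambda>(i, j). if j < s then A $$ (i, j) else 0)"
  have A': "A' \<in> carrier_mat p p" by (simp add: A'_def)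
  have "A' *\<^sub>v unit_vec p (p - 1) = 0\<^sub>v p"
  proof (rule eq_vecI)
    fix i assume "i < dim_vec (0\<^sub>v p :: real vec)"
    then have i: "i < p" by simp
    have "row A' i \<bullet> unit_vec p (p - 1) = row A' i $ (p - 1)"
      using i A' by (intro scalar_prod_right_unit) auto
    then show "(A' *\<^sub>v unit_vec p (p - 1)) $ i = 0\<^sub>v p $ i"
      using i A' \<open>s < p\<close> by (simp add: A'_def)
  qed (use A' in simp)
  moreover have "unit_vec p (p - 1) \<noteq> (0\<^sub>v p :: real vec)" using \<open>s < p\<close> by (intro unit_vec_nonzero) simp
  ultimately have "det A' = 0" using det_0_iff_vec_prod_zero[OF A'] by (metis unit_vec_carrier)
  then have "det (transpose_mat A') = 0" using det_transpose[OF A'] by simp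
  then obtain w where w: "w \<in> carrier_vec p" "w \<noteq> 0\<^sub>v p" "transpose_mat A' *\<^sub>v w = 0\<^sub>v p"
    using det_0_iff_vec_prod_zero[of "transpose_mat A'" p] A' by auto
  have "(\<Sum>i<p. w $ i * A $$ (i, j)) = 0" if j: "j < s" for j
  proof -
    have "(transpose_mat A' *\<^sub>v w) $ j = (\<Sum>i<p. A' $$ (i, j) * w $ i)"
      using A' w(1) j \<open>s < p\<close> by (simp add: scalar_prod_def lessThan_atLeast0)
    also have "\<dots> = (\<Sum>i<p. w $ i * A $$ (i, j))"
      using j \<open>s < p\<close> by (intro sum.cong) (auto simp: A'_def)
    finally show ?thesis using w(3) j \<open>s < p\<close> by simp
  qed
  then show ?thesis using w by blast
qed

lemma surrogate_weight_iff:
  "surrogate_weight M q Z p Y w \<longleftrightarrow> w \<in> carrier_vec p \<and> w \<noteq> 0\<^sub>v p \<and>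
     (\<forall>j<q. (\<Sum>i<p. w $ i * cross_cov M p Y q Z $$ (i, j)) = 0)"
proof (cases "w \<in> carrier_vec p")
  case True
  let ?C = "cross_cov M p Y q Z"
  have C: "?C \<in> carrier_mat p q" by (simp add: cross_cov_def)
  have e: "(mat_of_row w * ?C) $$ (0, j) = (\<Sum>i<p. w $ i * ?C $$ (i, j))" if "j < q" for j
    using C True that by (simp add: scalar_prod_def lessThan_atLeast0)
  have "mat_of_row w * ?C = 0\<^sub>m 1 q \<longleftrightarrow> (\<forall>j<q. (\<Sum>i<p. w $ i * ?C $$ (i, j)) = 0)"
  proof
    assume "mat_of_row w * ?C = 0\<^sub>m 1 q"
    then show "\<forall>j<q. (\<Sum>i<p. w $ i * ?C $$ (i, j)) = 0" using e by auto
  next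
    assume "\<forall>j<q. (\<Sum>i<p. w $ i * ?C $$ (i, j)) = 0"
    then show "mat_of_row w * ?C = 0\<^sub>m 1 q"
      using e C by (intro eq_matI) (auto simp del: index_mult_mat(1))
  qed
  then show ?thesis by (simp add: surrogate_weight_def)
qed (simp add: surrogate_weight_def)

section \<open>Measurability and independence of random vectors\<close>

lemma measurable_vec_index: "i < n \<Longrightarrow> (\<lambda>v. v $ i) \<in> borel_measurable (vec_borel n)"
  using measurable_vec_borel_iff[of "\<lambda>v. v" "vec_borel n" n] by simp

lemma space_vec_borel: "space (vec_borel n) = carrier_vec n"
  by (simp add: vec_borel_def)

lemma measurable_scalar_prod_left:
  assumes "w \<in> carrier_vec n"
  shows "(\<lambda>v. w \<bullet> v) \<in> borel_measurable (vec_borel n)"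
proof -
  have "(\<lambda>v. \<Sum>i<n. w $ i * v $ i) \<in> borel_measurable (vec_borel n)"
    by (intro borel_measurable_sum borel_measurable_times measurable_vec_index) auto
  moreover have "w \<bullet> v = (\<Sum>i<n. w $ i * v $ i)" if "v \<in> space (vec_borel n)" for v
    using that by (auto simp: scalar_prod_def space_vec_borel lessThan_atLeast0)
  ultimately show ?thesis by (subst measurable_cong)
qed

context prob_space
begin

lemma indep_rv_compose:
  assumes UW: "indep_rv M N U N' W" and f: "f \<in> measurable N L" and g: "g \<in> measurable N' L'"
  shows "indep_rv M L (\<lambda>x. f (U x)) L' (\<lambda>x. g (W x))"
proof -
  have U: "U \<in> measurable M N" and W: "W \<in> measurable M N'" using UW by (auto simp: indep_rv_def)
  have sub: "sigma_sets (space M) {(\<lambda>x. h (T x)) -` A \<inter> space M |A. A \<in> sets K'}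
      \<subseteq> sigma_sets (space M) {T -` A \<inter> space M |A. A \<in> sets K}"
    if T: "T \<in> measurable M K" and h: "h \<in> measurable K K'" for T h and K :: "'k measure" and K' :: "'l measure"
  proof (rule sigma_sets_mono')
    show "{(\<lambda>x. h (T x)) -` A \<inter> space M |A. A \<in> sets K'} \<subseteq> {T -` A \<inter> space M |A. A \<in> sets K}"
    proof clarify
      fix A assume A: "A \<in> sets K'"
      have "(\<lambda>x. h (T x)) -` A \<inter> space M = T -` (h -` A \<inter> space K) \<inter> space M"
        using measurable_space[OF T] by auto
      then show "\<exists>B. (\<lambda>x. h (T x)) -` A \<inter> space M = T -` B \<inter> space M \<and> B \<in> sets K"
        using measurable_sets[OF h A] by blast
    qed
  qed
  show ?thesis
    using UW sub[OF U f] sub[OF W g] measurable_compose[OF U f] measurable_compose[OF W g]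
    unfolding indep_rv_def indep_sets2_eq by blast
qed

lemma indep_rv_cong:
  assumes "indep_rv M N U N' W"
    and U: "\<And>x. x \<in> space M \<Longrightarrow> U x = U' x" and W: "\<And>x. x \<in> space M \<Longrightarrow> W x = W' x"
  shows "indep_rv M N U' N' W'"
proof -
  have "U -` A \<inter> space M = U' -` A \<inter> space M" "W -` B \<inter> space M = W' -` B \<inter> space M" for A B
    using U W by auto
  moreover have "U \<in> measurable M N \<longleftrightarrow> U' \<in> measurable M N" "W \<in> measurable M N' \<longleftrightarrow> W' \<in> measurable M N'"
    using U W by (auto intro!: measurable_cong)
  ultimately show ?thesis using assms(1) by (simp add: indep_rv_def)
qed

end

section \<open>Variables as linear combinations of the noises\<close>

context lin_nongaussian_model
begin

definition noise_combination :: "('a \<Rightarrow> real) \<Rightarrow> ('v \<Rightarrow> real) \<Rightarrow> bool" where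
  "noise_combination f c \<longleftrightarrow> (\<forall>x\<in>space M. f x = (\<Sum>k\<in>V. c k * noise k x))"

lemma noise_combination_sum:
  assumes "\<And>l. l \<in> I \<Longrightarrow> noise_combination (f l) (c l)"
  shows "noise_combination (\<lambda>x. \<Sum>l\<in>I. a l * f l x) (\<lambda>k. \<Sum>l\<in>I. a l * c l k)"
  unfolding noise_combination_def
proof
  fix x assume x: "x \<in> space M"
  have "(\<Sum>l\<in>I. a l * f l x) = (\<Sum>l\<in>I. a l * (\<Sum>k\<in>V. c l k * noise k x))"
    using assms x by (intro sum.cong) (auto simp: noise_combination_def)
  also have "\<dots> = (\<Sum>k\<in>V. \<Sum>l\<in>I. a l * c l k * noise k x)"
    by (simp add: sum_distrib_left mult.assoc) (rule sum.swap)
  finally show "(\<Sum>l\<in>I. a l * f l x) = (\<Sum>k\<in>V. (\<Sum>l\<in>I. a l * c l k) * noise k x)"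
    by (simp add: sum_distrib_right)
qed

lemma noise_combination_add:
  "noise_combination f c \<Longrightarrow> noise_combination g d \<Longrightarrow> noise_combination (\<lambda>x. f x + g x) (\<lambda>k. c k + d k)"
  by (simp add: noise_combination_def sum.distrib distrib_right)

lemma noise_combination_diff:
  "noise_combination f c \<Longrightarrow> noise_combination g d \<Longrightarrow> noise_combination (\<lambda>x. f x - g x) (\<lambda>k. c k - d k)"
  by (simp add: noise_combination_def sum_subtractf left_diff_distrib)

lemma noise_combination_cong:
  "noise_combination f c \<Longrightarrow> (\<And>x. x \<in> space M \<Longrightarrow> f x = g x) \<Longrightarrow> noise_combination g c"
  by (simp add: noise_combination_def)

text \<open>Substituting the combinations of the parents into the structural equation terminates,
  since a finite acyclic relation is well founded. The coefficients are total path effects in the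
  graph.\<close>

lemma variable_noise_combination:
  assumes "i \<in> V"
  shows "\<exists>c. noise_combination (X i) c"
proof -
  have "finite G" using G_subset finite_V by (meson finite_SigmaI finite_subset)
  then have "wf G" using acyclic_G finite_acyclic_wf by blast
  then show ?thesis using assms
  proof (induction i rule: wf_induct_rule)
    case (less i)
    define Pa where "Pa = {j. (j, i) \<in> G}"
    have Pa: "Pa \<subseteq> V" using G_subset by (auto simp: Pa_def)
    have "\<forall>j\<in>Pa. \<exists>c. noise_combination (X j) c" using less.IH Pa by (auto simp: Pa_def)
    then obtain c where "\<And>j. j \<in> Pa \<Longrightarrow> noise_combination (X j) (c j)" by metis
    then have "noise_combination (\<lambda>x. \<Sum>j\<in>Pa. b i j * X j x) (\<lambda>k. \<Sum>j\<in>Pa. b i j * c j k)"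
      by (rule noise_combination_sum)
    moreover have "noise_combination (noise i) (\<lambda>k. if k = i then 1 else 0)"
      using less.prems finite_V by (simp add: noise_combination_def if_distrib[of "\<lambda>u. u * _"] cong: if_cong)
    ultimately have "noise_combination (\<lambda>x. (\<Sum>j\<in>Pa. b i j * X j x) + noise i x)
        (\<lambda>k. (\<Sum>j\<in>Pa. b i j * c j k) + (if k = i then 1 else 0))"
      by (rule noise_combination_add)
    then have "noise_combination (X i) (\<lambda>k. (\<Sum>j\<in>Pa. b i j * c j k) + (if k = i then 1 else 0))"
      by (rule noise_combination_cong) (use structural less.prems in \<open>auto simp: Pa_def\<close>)
    then show ?case by blast
  qed
qed

lemma noise_measurable: "k \<in> V \<Longrightarrow> noise k \<in> borel_measurable M"
  using noise_indep by (auto simp: indep_vars_def)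

lemma noise_combination_integrable_mult:
  assumes "noise_combination f c" "noise_combination g d"
  shows "integrable M (\<lambda>x. f x * g x)"
proof -
  have "integrable M (\<lambda>x. \<Sum>k\<in>V. \<Sum>l\<in>V. (c k * noise k x) * (d l * noise l x))"
  proof (intro Bochner_Integration.integrable_sum)
    fix k l assume kl: "k \<in> V" "l \<in> V"
    note [measurable] = noise_measurable[OF kl(1)] noise_measurable[OF kl(2)]
    have "integrable M (\<lambda>x. noise k x * noise l x)"
    proof (rule Bochner_Integration.integrable_bound)
      show "integrable M (\<lambda>x. (noise k x)\<^sup>2 + (noise l x)\<^sup>2)"
        using noise_finite_variance kl by auto
      have "\<bar>noise k x * noise l x\<bar> \<le> (noise k x)\<^sup>2 + (noise l x)\<^sup>2" for x
      proof -
        have "2 * \<bar>noise k x\<bar> * \<bar>noise l x\<bar> \<le> (noise k x)\<^sup>2 + (noise l x)\<^sup>2"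
          using sum_squares_bound[of "\<bar>noise k x\<bar>" "\<bar>noise l x\<bar>"] by simp
        moreover have "0 \<le> \<bar>noise k x\<bar> * \<bar>noise l x\<bar>" by simp
        ultimately show ?thesis unfolding abs_mult by linarith
      qed
      then show "AE x in M. norm (noise k x * noise l x) \<le> norm ((noise k x)\<^sup>2 + (noise l x)\<^sup>2)" by simp
    qed measurable
    then have "integrable M (\<lambda>x. (c k * d l) * (noise k x * noise l x))" by simp
    then show "integrable M (\<lambda>x. (c k * noise k x) * (d l * noise l x))" by (simp add: mult_ac)
  qed
  then show ?thesis
    by (rule Bochner_Integration.integrable_cong[THEN iffD1, rotated -1])
      (use assms in \<open>auto simp: noise_combination_def sum_product\<close>)
qed

text \<open>A shared noise would have the characteristic function of a Gaussian or of a constant by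
  Darmois-Skitovich; \<open>v > 0\<close> contradicts non-Gaussianity and \<open>v = 0\<close>
  contradicts nonzero variance.\<close>

lemma independent_noise_combinations:
  assumes ind: "indep_var borel f borel g"
    and f: "noise_combination f c" and g: "noise_combination g d" and k: "k \<in> V"
  shows "c k = 0 \<or> d k = 0"
proof (rule ccontr)
  assume "\<not> (c k = 0 \<or> d k = 0)"
  moreover have "indep_var borel (\<lambda>x. \<Sum>k\<in>V. c k * noise k x) borel (\<lambda>x. \<Sum>k\<in>V. d k * noise k x)"
    unfolding indep_rv_iff_indep_var[symmetric]
    by (rule indep_rv_cong[OF ind[folded indep_rv_iff_indep_var]])
      (use f g in \<open>auto simp: noise_combination_def\<close>)
  ultimately obtain \<mu> v where v: "v \<ge> 0" and ch: "\<And>t. char (distr M borel (noise k)) t =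
      exp (\<i> * complex_of_real (\<mu> * t) - complex_of_real (v * t\<^sup>2))"
    using darmois_skitovich[OF finite_V noise_indep] k by blast
  show False
  proof (cases "v = 0")
    case True
    then have "variance (noise k) = 0"
      using ch by (intro variance_zero_of_char[OF noise_measurable[OF k]]) simp
    then show ?thesis using noise_nonzero_variance[OF k] by simp
  next
    case False
    then have "distributed M lborel (noise k) (normal_density \<mu> (sqrt (2 * v)))"
      using v ch by (intro gaussian_of_char noise_measurable k) auto
    then show ?thesis using noise_non_gaussian[OF k] v False
      by (metis less_eq_real_def mult_pos_pos real_sqrt_gt_zero zero_less_numeral)
  qed
qed

text \<open>Here coordinatewise information becomes joint independence: \<open>f\<close> is a
  function of the block of noises in \<open>K\<close>, the whole vector \<open>Z\<close> is a
  function of the complementary block, and disjoint blocks of independent variables are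
  independent.\<close>

lemma indep_of_disjoint_noise_support:
  assumes f: "noise_combination f c" and Z: "Z \<in> space M \<rightarrow> carrier_vec q"
    and Zd: "\<And>j. j < q \<Longrightarrow> noise_combination (\<lambda>x. Z x $ j) (d j)"
    and disj: "\<And>j k. j < q \<Longrightarrow> k \<in> V \<Longrightarrow> c k = 0 \<or> d j k = 0"
  shows "indep_rv M borel f (vec_borel q) Z"
proof -
  define K where "K = {k \<in> V. c k \<noteq> 0}"
  have "indep_var (PiM K (\<lambda>_. borel)) (\<lambda>x. restrict (\<lambda>k. noise k x) K)
      (PiM (V - K) (\<lambda>_. borel)) (\<lambda>x. restrict (\<lambda>k. noise k x) (V - K))"
    by (rule indep_var_restrict[OF noise_indep]) (auto simp: K_def)
  then have "indep_rv M (PiM K (\<lambda>_. borel)) (\<lambda>x. restrict (\<lambda>k. noise k x) K)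
      (PiM (V - K) (\<lambda>_. borel)) (\<lambda>x. restrict (\<lambda>k. noise k x) (V - K))"
    by (simp add: indep_rv_iff_indep_var)
  then have "indep_rv M borel (\<lambda>x. \<Sum>k\<in>K. c k * restrict (\<lambda>k. noise k x) K k)
      (vec_borel q) (\<lambda>x. vec q (\<lambda>j. \<Sum>k\<in>V - K. d j k * restrict (\<lambda>k. noise k x) (V - K) k))"
  proof (rule indep_rv_compose[of _ _ _ _ "\<lambda>h. \<Sum>k\<in>K. c k * h k" _ "\<lambda>h. vec q (\<lambda>j. \<Sum>k\<in>V - K. d j k * h k)"])
    show "(\<lambda>h. \<Sum>k\<in>K. c k * h k) \<in> borel_measurable (PiM K (\<lambda>_. borel))"
      by (intro borel_measurable_sum borel_measurable_times measurable_component_singleton) auto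
    show "(\<lambda>h. vec q (\<lambda>j. \<Sum>k\<in>V - K. d j k * h k)) \<in> measurable (PiM (V - K) (\<lambda>_. borel)) (vec_borel q)"
      unfolding measurable_vec_borel_iff
      by (auto intro!: borel_measurable_sum borel_measurable_times measurable_component_singleton)
  qed
  then show ?thesis
  proof (rule indep_rv_cong)
    fix x assume x: "x \<in> space M"
    have "(\<Sum>k\<in>K. c k * restrict (\<lambda>k. noise k x) K k) = (\<Sum>k\<in>V. c k * noise k x)"
      using finite_V by (intro sum.mono_neutral_cong_left) (auto simp: K_def)
    then show "(\<Sum>k\<in>K. c k * restrict (\<lambda>k. noise k x) K k) = f x"
      using f x by (simp add: noise_combination_def)
    have dim: "dim_vec (Z x) = q" using funcset_mem[OF Z x] by simp
    show "vec q (\<lambda>j. \<Sum>k\<in>V - K. d j k * restrict (\<lambda>k. noise k x) (V - K) k) = Z x"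
    proof (rule eq_vecI)
      show "dim_vec (vec q (\<lambda>j. \<Sum>k\<in>V - K. d j k * restrict (\<lambda>k. noise k x) (V - K) k)) = dim_vec (Z x)"
        by (simp add: dim)
      fix j assume "j < dim_vec (Z x)"
      then have j: "j < q" by (simp add: dim)
      have "(\<Sum>k\<in>V - K. d j k * restrict (\<lambda>k. noise k x) (V - K) k) = (\<Sum>k\<in>V. d j k * noise k x)"
        using finite_V disj[OF j] by (intro sum.mono_neutral_cong_left) (auto simp: K_def)
      then show "vec q (\<lambda>j. \<Sum>k\<in>V - K. d j k * restrict (\<lambda>k. noise k x) (V - K) k) $ j = Z x $ j"
        using Zd[OF j] x j by (simp add: noise_combination_def)
    qed
  qed
qed

end

theorem theorem1:
  fixes M :: "'a measure"
    and V :: "'v set"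
    and G :: "('v \<times> 'v) set"
    and b :: "'v \<Rightarrow> 'v \<Rightarrow> real"
    and X noise :: "'v \<Rightarrow> 'a \<Rightarrow> real"
    and s p q :: nat
    and S Y Z EY EZ :: "'a \<Rightarrow> real vec"
    and A B :: "real mat"
  assumes model: "lin_nongaussian_model M V G b X noise"
    and S_vars: "vector_of_variables M V X s S"
    and Y_vars: "vector_of_variables M V X p Y"
    and Z_vars: "vector_of_variables M V X q Z"
    and A_dim: "A \<in> carrier_mat p s"
    and B_dim: "B \<in> carrier_mat q s"
    and EY_vec: "EY \<in> measurable M (vec_borel p)"
    and EZ_vec: "EZ \<in> measurable M (vec_borel q)"
    and Y_eq: "\<And>x. x \<in> space M \<Longrightarrow> Y x = A *\<^sub>v S x + EY x"
    and Z_eq: "\<And>x. x \<in> space M \<Longrightarrow> Z x = B *\<^sub>v S x + EZ x"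
    and A_full_column_rank: "vec_space.rank p A = s"
    and dim_Y: "p > s"
    and EY_S_indep: "indep_rv M (vec_borel p) EY (vec_borel s) S"
    and EY_EZ_indep: "indep_rv M (vec_borel p) EY (vec_borel q) EZ"
    and cross_cov_rank: "vec_space.rank s (cross_cov M s S q Z) = s"
  shows "GIN M q Z p Y"
proof -
  interpret lin_nongaussian_model M V G b X noise by (rule model)
  have S_carr: "S x \<in> carrier_vec s" and Y_carr: "Y x \<in> carrier_vec p" and Z_carr: "Z x \<in> carrier_vec q"
    and EY_carr: "EY x \<in> carrier_vec p" and EZ_carr: "EZ x \<in> carrier_vec q" if "x \<in> space M" for x
    using that S_vars Y_vars Z_vars EY_vec EZ_vec by (auto simp: vector_of_variables_def measurable_vec_borel_iff)
  have comp: "\<exists>c. noise_combination (\<lambda>x. U x $ i) c \<and> integrable M (\<lambda>x. U x $ i) \<and> expectation (\<lambda>x. U x $ i) = 0"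
    if "vector_of_variables M V X n U" "i < n" for n U i
  proof -
    obtain v where v: "v \<in> V" "\<And>x. x \<in> space M \<Longrightarrow> U x $ i = X v x"
      using \<open>vector_of_variables M V X n U\<close> \<open>i < n\<close> unfolding vector_of_variables_def by blast
    obtain c where "noise_combination (X v) c" using variable_noise_combination[OF v(1)] by blast
    then have "noise_combination (\<lambda>x. U x $ i) c" by (rule noise_combination_cong) (simp add: v)
    moreover have "integrable M (\<lambda>x. U x $ i) \<longleftrightarrow> integrable M (X v)"
      using v by (intro Bochner_Integration.integrable_cong) auto
    moreover have "expectation (\<lambda>x. U x $ i) = expectation (X v)"
      using v by (intro Bochner_Integration.integral_cong) auto
    ultimately show ?thesis using zero_mean[OF v(1)] by auto
  qed
  obtain cS where cS: "\<And>l. l < s \<Longrightarrow> noise_combination (\<lambda>x. S x $ l) (cS l)" using comp[OF S_vars] by metis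
  obtain cY where cY: "\<And>i. i < p \<Longrightarrow> noise_combination (\<lambda>x. Y x $ i) (cY i)" using comp[OF Y_vars] by metis
  obtain cZ where cZ: "\<And>j. j < q \<Longrightarrow> noise_combination (\<lambda>x. Z x $ j) (cZ j)" using comp[OF Z_vars] by metis
  have Y_index: "Y x $ i = (\<Sum>l<s. A $$ (i, l) * S x $ l) + EY x $ i" if "i < p" "x \<in> space M" for i x
    using that A_dim S_carr[OF that(2)] EY_carr[OF that(2)] Y_eq[OF that(2)]
    by (simp add: scalar_prod_def lessThan_atLeast0)
  have Z_index: "Z x $ j = (\<Sum>l<s. B $$ (j, l) * S x $ l) + EZ x $ j" if "j < q" "x \<in> space M" for j x
    using that B_dim S_carr[OF that(2)] EZ_carr[OF that(2)] Z_eq[OF that(2)]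
    by (simp add: scalar_prod_def lessThan_atLeast0)
  \<comment> \<open>The error vectors need not be variables of the model, but as the differences
    \<open>Y - A S\<close> and \<open>Z - B S\<close> they are noise combinations all the
    same.\<close>
  define cE where "cE i k = cY i k - (\<Sum>l<s. A $$ (i, l) * cS l k)" for i k
  define cF where "cF j k = cZ j k - (\<Sum>l<s. B $$ (j, l) * cS l k)" for j k
  have cE: "noise_combination (\<lambda>x. EY x $ i) (cE i)" if i: "i < p" for i
  proof -
    have "noise_combination (\<lambda>x. Y x $ i - (\<Sum>l<s. A $$ (i, l) * S x $ l)) (cE i)"
      unfolding cE_def[abs_def] using cS i by (intro noise_combination_diff noise_combination_sum cY) auto
    then show ?thesis by (rule noise_combination_cong) (simp add: Y_index i)
  qed
  have cF: "noise_combination (\<lambda>x. EZ x $ j) (cF j)" if j: "j < q" for j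
  proof -
    have "noise_combination (\<lambda>x. Z x $ j - (\<Sum>l<s. B $$ (j, l) * S x $ l)) (cF j)"
      unfolding cF_def[abs_def] using cS j by (intro noise_combination_diff noise_combination_sum cZ) auto
    then show ?thesis by (rule noise_combination_cong) (simp add: Z_index j)
  qed
  have EY_int: "integrable M (\<lambda>x. EY x $ i)" and EY_mean: "expectation (\<lambda>x. EY x $ i) = 0" if i: "i < p" for i
  proof -
    have S: "integrable M (\<lambda>x. S x $ l)" "expectation (\<lambda>x. S x $ l) = 0" if "l < s" for l
      using comp[OF S_vars that] by auto
    have "integrable M (\<lambda>x. Y x $ i - (\<Sum>l<s. A $$ (i, l) * S x $ l))"
      using comp[OF Y_vars i] S by (intro Bochner_Integration.integrable_diff Bochner_Integration.integrable_sum) auto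
    moreover have "expectation (\<lambda>x. Y x $ i - (\<Sum>l<s. A $$ (i, l) * S x $ l)) = 0"
      using comp[OF Y_vars i] S by (subst Bochner_Integration.integral_diff) (auto simp: Bochner_Integration.integral_sum)
    moreover have "EY x $ i = Y x $ i - (\<Sum>l<s. A $$ (i, l) * S x $ l)" if "x \<in> space M" for x
      using Y_index[OF i that] by simp
    ultimately show "integrable M (\<lambda>x. EY x $ i)" "expectation (\<lambda>x. EY x $ i) = 0"
      by (simp_all cong: Bochner_Integration.integrable_cong Bochner_Integration.integral_cong)
  qed
  \<comment> \<open>Independence of \<open>EY\<close> and \<open>Z\<close> is not yet available.
    Splitting \<open>Z = B S + EZ\<close> suffices here, as the expectation is linear and
    \<open>EY\<close> is centred and independent of each part.\<close>
  have EY_Z: "expectation (\<lambda>x. EY x $ i * Z x $ j) = 0" if i: "i < p" and j: "j < q" for i j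
  proof -
    have zero: "expectation (\<lambda>x. EY x $ i * U x $ l) = 0"
      if ind: "indep_rv M (vec_borel p) EY (vec_borel n) U" and l: "l < n" and int: "integrable M (\<lambda>x. U x $ l)" for n U l
    proof -
      have "indep_var borel (\<lambda>x. EY x $ i) borel (\<lambda>x. U x $ l)"
        unfolding indep_rv_iff_indep_var[symmetric]
        by (rule indep_rv_compose[OF ind]) (intro measurable_vec_index i l)+
      from indep_var_lebesgue_integral[OF this EY_int[OF i] int] show ?thesis by (simp add: EY_mean[OF i])
    qed
    have S: "integrable M (\<lambda>x. S x $ l)" if "l < s" for l using comp[OF S_vars that] by auto
    have EZ: "integrable M (\<lambda>x. EZ x $ j)"
    proof -
      have "integrable M (\<lambda>x. Z x $ j - (\<Sum>l<s. B $$ (j, l) * S x $ l))"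
        using comp[OF Z_vars j] S by (intro Bochner_Integration.integrable_diff Bochner_Integration.integrable_sum) auto
      moreover have "EZ x $ j = Z x $ j - (\<Sum>l<s. B $$ (j, l) * S x $ l)" if "x \<in> space M" for x
        using Z_index[OF j that] by simp
      ultimately show ?thesis by (simp cong: Bochner_Integration.integrable_cong)
    qed
    have int: "integrable M (\<lambda>x. EY x $ i * S x $ l)" if "l < s" for l
      using noise_combination_integrable_mult[OF cE[OF i] cS[OF that]] .
    have "expectation (\<lambda>x. EY x $ i * Z x $ j)
       = expectation (\<lambda>x. (\<Sum>l<s. B $$ (j, l) * (EY x $ i * S x $ l)) + EY x $ i * EZ x $ j)"
      using j by (intro Bochner_Integration.integral_cong) (auto simp: Z_index distrib_left sum_distrib_left mult_ac)
    also have "\<dots> = (\<Sum>l<s. B $$ (j, l) * expectation (\<lambda>x. EY x $ i * S x $ l)) + expectation (\<lambda>x. EY x $ i * EZ x $ j)"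
      using int noise_combination_integrable_mult[OF cE[OF i] cF[OF j]]
      by (subst Bochner_Integration.integral_add) (auto simp: Bochner_Integration.integral_sum)
    also have "\<dots> = 0" using zero[OF EY_S_indep _ S] zero[OF EY_EZ_indep j EZ] by simp
    finally show ?thesis .
  qed
  define T where "T = cross_cov M s S q Z"
  have T: "T \<in> carrier_mat s q" by (simp add: T_def cross_cov_def)
  have cov: "cross_cov M p Y q Z $$ (i, j) = (\<Sum>l<s. A $$ (i, l) * T $$ (l, j))" if i: "i < p" and j: "j < q" for i j
  proof -
    have int: "integrable M (\<lambda>x. S x $ l * Z x $ j)" if "l < s" for l
      using noise_combination_integrable_mult[OF cS[OF that] cZ[OF j]] .
    have "cross_cov M p Y q Z $$ (i, j) = expectation (\<lambda>x. (\<Sum>l<s. A $$ (i, l) * (S x $ l * Z x $ j)) + EY x $ i * Z x $ j)"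
      using i j by (auto simp: cross_cov_def Y_index distrib_right sum_distrib_right mult.assoc
          intro!: Bochner_Integration.integral_cong)
    also have "\<dots> = (\<Sum>l<s. A $$ (i, l) * expectation (\<lambda>x. S x $ l * Z x $ j)) + expectation (\<lambda>x. EY x $ i * Z x $ j)"
      using int noise_combination_integrable_mult[OF cE[OF i] cZ[OF j]]
      by (subst Bochner_Integration.integral_add) (auto simp: Bochner_Integration.integral_sum)
    also have "\<dots> = (\<Sum>l<s. A $$ (i, l) * T $$ (l, j))"
      using j by (simp add: EY_Z i T_def cross_cov_def)
    finally show ?thesis .
  qed
  have weight: "(\<Sum>i<p. w $ i * cross_cov M p Y q Z $$ (i, j)) = (\<Sum>l<s. (\<Sum>i<p. w $ i * A $$ (i, l)) * T $$ (l, j))"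
    if "j < q" for w :: "real vec" and j
  proof -
    have "(\<Sum>i<p. w $ i * cross_cov M p Y q Z $$ (i, j)) = (\<Sum>i<p. \<Sum>l<s. w $ i * A $$ (i, l) * T $$ (l, j))"
      using that by (intro sum.cong) (auto simp: cov sum_distrib_left mult.assoc)
    then show ?thesis by (subst (asm) sum.swap) (simp add: sum_distrib_right)
  qed
  have annihilates: "(\<Sum>i<p. w $ i * A $$ (i, l)) = 0" if w: "surrogate_weight M q Z p Y w" and l: "l < s" for w l
  proof -
    define u where "u = vec s (\<lambda>l. \<Sum>i<p. w $ i * A $$ (i, l))"
    have "u = 0\<^sub>v s"
    proof (rule full_row_rank_left_kernel[OF T])
      show "vec_space.rank s T = s" using cross_cov_rank by (simp add: T_def)
      show "u \<in> carrier_vec s" by (simp add: u_def)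
      show "col T j \<bullet> u = 0" if j: "j < q" for j
      proof -
        have "col T j \<bullet> u = (\<Sum>l<s. (\<Sum>i<p. w $ i * A $$ (i, l)) * T $$ (l, j))"
          using T j by (simp add: scalar_prod_def u_def lessThan_atLeast0 mult.commute)
        also have "\<dots> = 0" using w j by (simp add: surrogate_weight_iff flip: weight)
        finally show ?thesis .
      qed
    qed
    then have "u $ l = 0" using l by simp
    then show ?thesis using l by (simp add: u_def)
  qed
  show ?thesis
    unfolding GIN_def
  proof (intro conjI allI impI)
    \<comment> \<open>A weight that annihilates \<open>A\<close> exists since \<open>s < p\<close>,
      and by \<open>weight\<close> it annihilates the cross-covariance.\<close>
    obtain w where "w \<in> carrier_vec p" "w \<noteq> 0\<^sub>v p" "\<And>l. l < s \<Longrightarrow> (\<Sum>i<p. w $ i * A $$ (i, l)) = 0"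
      using left_kernel_nontrivial[OF A_dim dim_Y] by blast
    then have "surrogate_weight M q Z p Y w" by (simp add: surrogate_weight_iff weight)
    then show "\<exists>w. surrogate_weight M q Z p Y w" by blast
  next
    fix w assume w: "surrogate_weight M q Z p Y w"
    have wp: "w \<in> carrier_vec p" using w by (simp add: surrogate_weight_iff)
    define c where "c k = (\<Sum>i<p. w $ i * cE i k)" for k
    have EY_sum: "w \<bullet> EY x = (\<Sum>i<p. w $ i * EY x $ i)" if "x \<in> space M" for x
      using EY_carr[OF that] by (simp add: scalar_prod_def lessThan_atLeast0)
    have wY: "w \<bullet> Y x = w \<bullet> EY x" if x: "x \<in> space M" for x
    proof -
      have "w \<bullet> Y x = (\<Sum>i<p. w $ i * Y x $ i)"
        using Y_carr[OF x] by (simp add: scalar_prod_def lessThan_atLeast0)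
      also have "\<dots> = (\<Sum>i<p. \<Sum>l<s. w $ i * A $$ (i, l) * S x $ l) + (\<Sum>i<p. w $ i * EY x $ i)"
        using x by (simp add: Y_index distrib_left sum.distrib sum_distrib_left mult.assoc)
      also have "(\<Sum>i<p. \<Sum>l<s. w $ i * A $$ (i, l) * S x $ l) = (\<Sum>l<s. (\<Sum>i<p. w $ i * A $$ (i, l)) * S x $ l)"
        by (subst sum.swap) (simp add: sum_distrib_right)
      also have "\<dots> = 0" using annihilates[OF w] by simp
      finally show ?thesis using EY_sum[OF x] by simp
    qed
    have cEY: "noise_combination (\<lambda>x. w \<bullet> EY x) c"
    proof -
      have "noise_combination (\<lambda>x. \<Sum>i<p. w $ i * EY x $ i) c"
        unfolding c_def[abs_def] by (rule noise_combination_sum) (simp add: cE)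
      then show ?thesis by (rule noise_combination_cong) (simp add: EY_sum)
    qed
    \<comment> \<open>Stated for a general \<open>U\<close> because it is applied to
      \<open>S\<close> and to \<open>EZ\<close> separately, one coordinate at a time.\<close>
    have disj: "c k = 0 \<or> d k = 0"
      if ind: "indep_rv M (vec_borel p) EY (vec_borel n) U" and l: "l < n"
        and U: "noise_combination (\<lambda>x. U x $ l) d" and k: "k \<in> V" for n U l d k
    proof -
      have "indep_var borel (\<lambda>x. w \<bullet> EY x) borel (\<lambda>x. U x $ l)"
        unfolding indep_rv_iff_indep_var[symmetric]
        by (rule indep_rv_compose[OF ind measurable_scalar_prod_left[OF wp] measurable_vec_index[OF l]])
      then show ?thesis by (rule independent_noise_combinations[OF _ cEY U k])
    qed
    have "indep_rv M borel (\<lambda>x. w \<bullet> EY x) (vec_borel q) Z"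
    proof (rule indep_of_disjoint_noise_support[OF cEY _ cZ])
      show "Z \<in> space M \<rightarrow> carrier_vec q" using Z_carr by auto
      fix j k assume j: "j < q" and k: "k \<in> V"
      \<comment> \<open>A noise with nonzero coefficient in \<open>w \<bullet> EY\<close> has
        coefficient \<open>0\<close> in every \<open>S\<close> coordinate and in the
        \<open>EZ\<close> coordinate, hence also in this linear combination of them. Any dependence
        between \<open>S\<close> and \<open>EZ\<close> is harmless at the level of
        coefficients.\<close>
      have "cZ j k = cF j k + (\<Sum>l<s. B $$ (j, l) * cS l k)" by (simp add: cF_def)
      moreover have "c k = 0 \<or> cS l k = 0" if "l < s" for l
        using disj[OF EY_S_indep that cS[OF that] k] .
      moreover have "c k = 0 \<or> cF j k = 0" using disj[OF EY_EZ_indep j cF[OF j] k] .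
      ultimately show "c k = 0 \<or> cZ j k = 0" by (cases "c k = 0") auto
    qed
    then show "indep_rv M borel (\<lambda>x. w \<bullet> Y x) (vec_borel q) Z"
      by (rule indep_rv_cong) (simp_all add: wY)
  qed
qed

end
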